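(* Let $z\in S_\infty$ be an involution and $i\in\mathbb{Z}_{>0}$. Then \[\partial^{(\beta)}_i\widehat{\mathcal{G}}_z=\begin{cases}\widehat{\mathcal{G}}_{zs_i}&\text{if }z(i)>z(i+1)\text{ and }z(i)=i+1,\\ \widehat{\mathcal{G}}_{s_izs_i}&\text{if }z(i)>z(i+1)\text{ and }z(i)\ne i+1,\\ -\beta\widehat{\mathcal{G}}_z&\text{if }z(i)<z(i+1).\end{cases}\]
   Context: $S_\infty$: permutations of $\mathbb{Z}$ fixing $i\le0$ and all but finitely many $i$; $s_i=(i,i+1)$; $\ell$ = number of inversions. $\partial_if=(f-s_if)/(x_i-x_{i+1})$ (with $s_i$ swapping $x_i,x_{i+1}$), $\partial^{(\beta)}_if=\partial_i((1+\beta x_{i+1})f)$. Grothendieck polynomials $\mathcal{G}^{(\beta)}_w$: $\mathcal{G}^{(\beta)}_{n\cdots21}=x_1^{n-1}\cdots x_{n-1}$ and $\partial^{(\beta)}_i\mathcal{G}^{(\beta)}_w=\mathcal{G}^{(\beta)}_{ws_i}$ if $w(i)>w(i+1)$, else $-\beta\mathcal{G}^{(\beta)}_w$. Demazure product $\circ$: associative product on $S_\infty$ with $s_i\circ w=s_iw$ if $\ell(s_iw)>\ell(w)$, else $w$ (and similarly on the right). For an involution $z$: $\mathcal{B}_{\mathsf{inv}}(z)=\{w:w^{-1}\circ w=z\}$, $\ell_{\mathsf{inv}}(z)=(\ell(z)+|\{a>0:a<z(a)\}|)/2$, $\widehat{\mathcal{G}}_z=\sum_{w\in\mathcal{B}_{\mathsf{inv}}(z)}\beta^{\ell(w)-\ell_{\mathsf{inv}}(z)}\mathcal{G}^{(\beta)}_w$.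 *)

theory Defs
  imports
    "HOL-Library.FuncSet"
    "HOL-Library.Poly_Mapping"
    "HOL-Computational_Algebra.Polynomial"
    "HOL-Combinatorics.Transposition"
begin

definition S_inf :: "(int \<Rightarrow> int) set" where
  "S_inf = {w. bij w \<and> (\<forall>i\<le>0. w i = i) \<and> finite {i. w i \<noteq> i}}"

abbreviation simple_refl :: "int \<Rightarrow> int \<Rightarrow> int" where
  "simple_refl i \<equiv> transpose i (i + 1)"

definition perm_length :: "(int \<Rightarrow> int) \<Rightarrow> nat" where
  "perm_length w = card {(i, j). i < j \<and> w i > w j}"

text \<open>There is exactly one such operation: it is closed and associative on \<open>S_inf\<close>, and obeys
  the rules for multiplication by a simple reflection on either side.  Membership in the
  extensional function space makes it unique also as a HOL function.\<close>

definition is_demazure_product ::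
    "((int \<Rightarrow> int) \<Rightarrow> (int \<Rightarrow> int) \<Rightarrow> (int \<Rightarrow> int)) \<Rightarrow> bool" where
  "is_demazure_product D \<longleftrightarrow>
     D \<in> S_inf \<rightarrow>\<^sub>E (S_inf \<rightarrow>\<^sub>E S_inf) \<and>
     (\<forall>u\<in>S_inf. \<forall>v\<in>S_inf. \<forall>w\<in>S_inf. D (D u v) w = D u (D v w)) \<and>
     (\<forall>w\<in>S_inf. \<forall>i>0.
        D (simple_refl i) w =
          (if perm_length (simple_refl i \<circ> w) > perm_length w then simple_refl i \<circ> w else w) \<and>
        D w (simple_refl i) =
          (if perm_length (w \<circ> simple_refl i) > perm_length w then w \<circ> simple_refl i else w))"

definition demazure :: "(int \<Rightarrow> int) \<Rightarrow> (int \<Rightarrow> int) \<Rightarrow> (int \<Rightarrow> int)" where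
  "demazure = (THE D. is_demazure_product D)"

text \<open>Polynomials in variables \<open>x\<^sub>i\<close> are finitely supported maps from exponent vectors to
  coefficients.  Variables are indexed by \<open>int\<close> to match the permutations; only those with
  positive index occur in the Grothendieck polynomials.  The coefficient ring \<open>\<int>[\<beta>]\<close> is
  \<open>int poly\<close>, with its indeterminate as \<open>\<beta>\<close>.\<close>

type_synonym beta_mpoly = "(int \<Rightarrow>\<^sub>0 nat) \<Rightarrow>\<^sub>0 int poly"

definition X :: "int \<Rightarrow> beta_mpoly" where
  "X i = Poly_Mapping.single (Poly_Mapping.single i 1) 1"

definition \<beta> :: beta_mpoly where
  "\<beta> = Poly_Mapping.single 0 [:0, 1:]"

text \<open>\<open>map_key\<close> is precomposition, so the inner one permutes the entries of an exponent vector
  and the outer one permutes the monomials; as the transposition is its own inverse, the result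
  exchanges \<open>X i\<close> and \<open>X (i + 1)\<close>.\<close>

definition swap_vars :: "int \<Rightarrow> beta_mpoly \<Rightarrow> beta_mpoly" where
  "swap_vars i f = Poly_Mapping.map_key (Poly_Mapping.map_key (simple_refl i)) f"

text \<open>The quotient \<open>(f - s\<^sub>i f) / (x\<^sub>i - x\<^sub>i\<^sub>+\<^sub>1)\<close>, which is a polynomial; it is unique since
  the ring is an integral domain.\<close>

definition div_diff :: "int \<Rightarrow> beta_mpoly \<Rightarrow> beta_mpoly" where
  "div_diff i f = (THE g. (X i - X (i + 1)) * g = f - swap_vars i f)"

definition div_diff_beta :: "int \<Rightarrow> beta_mpoly \<Rightarrow> beta_mpoly" where
  "div_diff_beta i f = div_diff i ((1 + \<beta> * X (i + 1)) * f)"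

definition longest_perm :: "nat \<Rightarrow> int \<Rightarrow> int" where
  "longest_perm n i = (if 1 \<le> i \<and> i \<le> int n then int n + 1 - i else i)"

text \<open>Exactly one family satisfies these conditions (as for the Demazure product, extensionality
  fixes the values outside \<open>S_inf\<close>).\<close>

definition is_grothendieck_family :: "((int \<Rightarrow> int) \<Rightarrow> beta_mpoly) \<Rightarrow> bool" where
  "is_grothendieck_family G \<longleftrightarrow>
     G \<in> extensional S_inf \<and>
     (\<forall>n\<ge>1. G (longest_perm n) = (\<Prod>k=1..<n. X (int k) ^ (n - k))) \<and>
     (\<forall>w\<in>S_inf. \<forall>i>0.
        div_diff_beta i (G w) = (if w i > w (i + 1) then G (w \<circ> simple_refl i) else - \<beta> * G w))"

definition grothendieck :: "(int \<Rightarrow> int) \<Rightarrow> beta_mpoly" where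
  "grothendieck = (THE G. is_grothendieck_family G)"

definition B_inv :: "(int \<Rightarrow> int) \<Rightarrow> (int \<Rightarrow> int) set" where
  "B_inv z = {w \<in> S_inf. demazure (inv w) w = z}"

text \<open>For an involution \<open>z\<close> in \<open>S_inf\<close> the sum below is even, so the division is exact.\<close>

definition inv_length :: "(int \<Rightarrow> int) \<Rightarrow> nat" where
  "inv_length z = (perm_length z + card {a. 0 < a \<and> a < z a}) div 2"

text \<open>Every \<open>w\<close> in \<open>B_inv z\<close> has length at least \<open>inv_length z\<close>, so the subtraction in the
  exponent does not truncate; and \<open>B_inv z\<close> is finite.\<close>

definition inv_grothendieck :: "(int \<Rightarrow> int) \<Rightarrow> beta_mpoly" where
  "inv_grothendieck z =
     (\<Sum>w\<in>B_inv z. \<beta> ^ (perm_length w - inv_length z) * grothendieck w)"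

end

theory Submission
  imports Defs "HOL-Combinatorics.Permutations"
begin

text \<open>Demazure multiplications by simple reflections on the left and on the right
  commute, which makes the Demazure product well defined.  The Grothendieck polynomials exist because,
  in the 0-Hecke algebra, the product of the factors \<open>1 + x\<^sub>k u\<^sub>j\<close> (Fomin--Kirillov) satisfies
  \<open>\<partial>\<^sub>i\<^sup>\<beta> P = P (u\<^sub>i - \<beta>)\<close>, so its coefficients obey the defining recursion.
  If \<open>i\<close> is a descent of \<open>z\<close>, then there is a unique involution \<open>y\<close> with an ascent at \<open>i\<close>
  and \<open>s\<^sub>i \<circ> y \<circ> s\<^sub>i = z\<close> (Demazure products).  The elements of \<open>\<B>\<^sub>i\<^sub>n\<^sub>v(z)\<close> are
  those \<open>v\<close> with an ascent at \<open>i\<close>, the products \<open>v s\<^sub>i\<close> for these \<open>v\<close>, and the \<open>v s\<^sub>i\<close> with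
  \<open>v \<in> \<B>\<^sub>i\<^sub>n\<^sub>v(y)\<close>.  Under \<open>\<partial>\<^sub>i\<^sup>\<beta>\<close> the first two families cancel and the third gives
  the polynomial of \<open>y\<close>.\<close>

section \<open>Finitely supported permutations\<close>

lemma S_infD:
  assumes "w \<in> S_inf"
  shows "bij w" and "inj w" and "surj w" and "p \<le> 0 \<Longrightarrow> w p = p" and "finite {p. w p \<noteq> p}"
  using assms by (auto simp: S_inf_def bij_def)

lemma S_inf_pos:
  assumes "w \<in> S_inf" "p > 0"
  shows "w p > 0"
proof (rule ccontr)
  assume "\<not> w p > 0"
  then have "w (w p) = w p"
    using S_infD(4)[OF assms(1), of "w p"] by simp
  then have "w p = p"
    using S_infD(2)[OF assms(1)] by (rule injD[rotated])
  then show False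
    using assms(2) \<open>\<not> w p > 0\<close> by simp
qed

lemma S_inf_neq_Suc:
  assumes "w \<in> S_inf"
  shows "w p \<noteq> w (p + 1)" "w (p + 1) \<noteq> w p"
  using inj_eq[OF S_infD(2)[OF assms]] by simp_all

lemma id_in_S_inf [simp]: "id \<in> S_inf"
  by (simp add: S_inf_def)

lemma comp_in_S_inf [simp]:
  assumes "u \<in> S_inf" "v \<in> S_inf"
  shows "u \<circ> v \<in> S_inf"
proof -
  have "{p. (u \<circ> v) p \<noteq> p} \<subseteq> {p. u p \<noteq> p} \<union> {p. v p \<noteq> p}"
    by auto
  then have "finite {p. (u \<circ> v) p \<noteq> p}"
    by (rule finite_subset) (use S_infD(5) assms in simp)
  then show ?thesis
    using assms by (auto simp: S_inf_def bij_comp)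
qed

lemma inv_in_S_inf [simp]:
  assumes "w \<in> S_inf"
  shows "inv w \<in> S_inf"
proof -
  have "inv w p = p \<longleftrightarrow> w p = p" for p
    using S_infD(1)[OF assms] by (metis bij_inv_eq_iff)
  then show ?thesis
    using assms by (simp add: S_inf_def bij_imp_bij_inv)
qed

lemma simple_refl_in_S_inf [simp]:
  assumes "i > 0"
  shows "simple_refl i \<in> S_inf"
proof -
  have "{p. simple_refl i p \<noteq> p} \<subseteq> {i, i + 1}"
    by (auto simp: transpose_def)
  then have "finite {p. simple_refl i p \<noteq> p}"
    by (rule finite_subset) simp
  then show ?thesis
    using assms by (simp add: S_inf_def)
qed

lemma comp_simple_refl_twice [simp]: "w \<circ> simple_refl i \<circ> simple_refl i = w"
  by (simp add: comp_assoc)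

lemma comp_simple_refl_eq_iff: "u \<circ> simple_refl i = w \<longleftrightarrow> u = w \<circ> simple_refl i"
  by auto

section \<open>The finite symmetric groups on 1..n inside \<open>S_inf\<close>\<close>

definition S_fin :: "int \<Rightarrow> (int \<Rightarrow> int) set" where
  "S_fin n = {w \<in> S_inf. \<forall>p>n. w p = p}"

lemma S_finD:
  assumes "w \<in> S_fin n"
  shows "w \<in> S_inf" "p > n \<Longrightarrow> w p = p" "p \<le> n \<Longrightarrow> w p \<le> n"
proof -
  show *: "w \<in> S_inf" and **: "p > n \<Longrightarrow> w p = p" for p
    using assms by (auto simp: S_fin_def)
  show "w p \<le> n" if "p \<le> n"
  proof (rule ccontr)
    assume "\<not> w p \<le> n"
    then have "w (w p) = w p"
      using ** by simp
    then have "w p = p"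
      using S_infD(2)[OF *] by (rule injD[rotated])
    then show False
      using that \<open>\<not> w p \<le> n\<close> by simp
  qed
qed

lemma S_fin_mono: "m \<le> n \<Longrightarrow> S_fin m \<subseteq> S_fin n"
  by (auto simp: S_fin_def)

lemma S_inf_imp_S_fin:
  assumes "w \<in> S_inf"
  obtains n :: nat where "w \<in> S_fin (int n)"
proof -
  have "bdd_above {p. w p \<noteq> p}"
    using S_infD(5)[OF assms] by (rule bdd_above_finite)
  then obtain M where M: "\<And>p. w p \<noteq> p \<Longrightarrow> p \<le> M"
    by (auto simp: bdd_above_def)
  then have "w \<in> S_fin (int (nat M))"
    using assms by (force simp: S_fin_def)
  then show ?thesis ..
qed

lemma id_in_S_fin [simp]: "id \<in> S_fin n"
  by (simp add: S_fin_def)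

lemma comp_in_S_fin [simp]: "u \<in> S_fin n \<Longrightarrow> v \<in> S_fin n \<Longrightarrow> u \<circ> v \<in> S_fin n"
  by (simp add: S_fin_def)

lemma simple_refl_in_S_fin [simp]: "i > 0 \<Longrightarrow> i < n \<Longrightarrow> simple_refl i \<in> S_fin n"
  by (simp add: S_fin_def)

lemma S_fin_ascent:
  assumes "w \<in> S_fin n" "i \<ge> n"
  shows "w i < w (i + 1)"
proof (cases "i = n")
  case True
  then show ?thesis
    using S_finD(2)[OF assms(1), of "i + 1"] S_finD(3)[OF assms(1), of i] by simp
next
  case False
  then show ?thesis
    using assms by (simp add: S_finD(2)[OF assms(1)])
qed

lemma finite_S_fin: "finite (S_fin n)"
proof -
  have "S_fin n \<subseteq> {p. p permutes {1..n}}"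
    unfolding permutes_bij
    by (auto simp: S_fin_def S_inf_def permutes_def bij_iff)
  then show ?thesis
    using finite_permutations[of "{1..n}"] finite_subset by blast
qed

section \<open>Length and descents\<close>

lemma inversions_subset:
  assumes "w \<in> S_fin n"
  shows "{(a, b). a < b \<and> w a > w b} \<subseteq> {1..n} \<times> {1..n}"
proof -
  have w: "w \<in> S_inf"
    using S_finD(1)[OF assms] .
  have "a \<in> {1..n} \<and> b \<in> {1..n}" if ab: "a < b" "w b < w a" for a b
  proof -
    have "a > 0"
      using ab S_infD(4)[OF w, of a] S_infD(4)[OF w, of b] S_inf_pos[OF w, of b] by linarith
    moreover have "b \<le> n"
      using ab S_finD(2)[OF assms, of b] S_finD(2)[OF assms, of a] S_finD(3)[OF assms, of a] by linarith
    ultimately show ?thesis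
      using ab by simp
  qed
  then show ?thesis
    by blast
qed

lemma finite_inversions:
  assumes "w \<in> S_inf"
  shows "finite {(a, b). a < b \<and> w a > w b}"
proof -
  obtain n :: nat where "w \<in> S_fin (int n)"
    using S_inf_imp_S_fin[OF assms] .
  from inversions_subset[OF this] show ?thesis
    by (rule finite_subset) simp
qed

lemma perm_length_le:
  assumes "w \<in> S_fin (int n)"
  shows "perm_length w \<le> n * n"
proof -
  have "perm_length w \<le> card ({1..int n} \<times> {1..int n})"
    unfolding perm_length_def by (rule card_mono[OF _ inversions_subset[OF assms]]) simp
  then show ?thesis
    by (simp add: card_cartesian_product)
qed

lemma perm_length_id [simp]: "perm_length id = 0"
proof -
  have "{(a, b). a < b \<and> id a > (id b :: int)} = {}"
    by auto
  then show ?thesis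
    by (simp only: perm_length_def card.empty)
qed

text \<open>Applying s_i to both entries carries the inversions of \<open>w\<close> bijectively onto
  those of \<open>w s_i\<close> other than the new one, (i, i+1), because s_i reverses the order of
  no other pair of positions.\<close>

lemma perm_length_ascent:
  assumes w: "w \<in> S_inf" and asc: "w i < w (i + 1)"
  shows "perm_length (w \<circ> simple_refl i) = Suc (perm_length w)"
proof -
  let ?s = "simple_refl i"
  let ?I = "\<lambda>v. {(a, b). a < b \<and> v a > v b} :: (int \<times> int) set"
  have eq: "?I (w \<circ> ?s) = insert (i, i + 1) (map_prod ?s ?s ` ?I w)" (is "?L = ?R")
  proof (intro equalityI subsetI)
    fix x assume "x \<in> ?L"
    then obtain a b where x: "x = (a, b)" "a < b" "w (?s a) > w (?s b)"
      by auto
    show "x \<in> ?R"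
    proof (cases "x = (i, i + 1)")
      case False
      then have "?s a < ?s b"
        using x by (auto simp: transpose_def)
      then have "(?s a, ?s b) \<in> ?I w"
        using x by simp
      moreover have "x = map_prod ?s ?s (?s a, ?s b)"
        using x by simp
      ultimately show ?thesis
        by blast
    qed simp
  next
    fix x assume "x \<in> ?R"
    then consider "x = (i, i + 1)" | a b where "x = (?s a, ?s b)" "a < b" "w a > w b"
      by auto
    then show "x \<in> ?L"
    proof cases
      case 1
      then show ?thesis
        using asc by simp
    next
      case 2
      then have "(a, b) \<noteq> (i, i + 1)"
        using asc by auto
      then have "?s a < ?s b"
        using 2 by (auto simp: transpose_def)
      then show ?thesis
        using 2 by simp
    qed
  qed
  have "(i, i + 1) \<notin> map_prod ?s ?s ` ?I w"
    by (auto simp: transpose_def split: if_splits)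
  moreover have "inj_on (map_prod ?s ?s) (?I w)"
    by (rule inj_on_subset[OF prod.inj_map]) (simp_all add: inj_transpose)
  ultimately show ?thesis
    unfolding perm_length_def eq using finite_inversions[OF w] by (simp add: card_image)
qed

lemma perm_length_descent:
  assumes "w \<in> S_inf" "i > 0" "w (i + 1) < w i"
  shows "perm_length w = Suc (perm_length (w \<circ> simple_refl i))"
  using perm_length_ascent[of "w \<circ> simple_refl i" i] assms by simp

lemma perm_length_less_iff:
  assumes "w \<in> S_inf" "i > 0"
  shows "perm_length w < perm_length (w \<circ> simple_refl i) \<longleftrightarrow> w i < w (i + 1)"
  using perm_length_ascent[OF assms(1)] perm_length_descent[OF assms] S_inf_neq_Suc(1)[OF assms(1), of i]
  by (smt (verit) lessI not_less_iff_gr_or_eq)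

lemma inv_inv_S_inf [simp]: "w \<in> S_inf \<Longrightarrow> inv (inv w) = w"
  using S_infD(1) by (rule inv_inv_eq)

lemma inv_comp_S_inf: "u \<in> S_inf \<Longrightarrow> v \<in> S_inf \<Longrightarrow> inv (u \<circ> v) = inv v \<circ> inv u"
  by (simp add: S_infD(1) o_inv_distrib)

lemma perm_length_inv:
  assumes "w \<in> S_inf"
  shows "perm_length (inv w) = perm_length w"
proof -
  have [simp]: "inv w (w p) = p" "w (inv w p) = p" for p
    using S_infD(2,3)[OF assms] by (simp_all add: surj_f_inv_f)
  have "bij_betw (\<lambda>(a, b). (w b, w a)) {(a, b). a < b \<and> w a > w b} {(a, b). a < b \<and> inv w a > inv w b}"
    by (rule bij_betw_byWitness[where f' = "\<lambda>(a, b). (inv w b, inv w a)"]) auto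
  then show ?thesis
    unfolding perm_length_def by (rule bij_betw_same_card[symmetric])
qed

lemma perm_length_less_iff_left:
  assumes "w \<in> S_inf" "i > 0"
  shows "perm_length w < perm_length (simple_refl i \<circ> w) \<longleftrightarrow> inv w i < inv w (i + 1)"
proof -
  have "inv (simple_refl i \<circ> w) = inv w \<circ> simple_refl i"
    using assms by (simp add: inv_comp_S_inf)
  then have "perm_length (simple_refl i \<circ> w) = perm_length (inv w \<circ> simple_refl i)"
    using perm_length_inv[of "simple_refl i \<circ> w"] assms by simp
  then show ?thesis
    using perm_length_less_iff[of "inv w" i] perm_length_inv[of w] assms by simp
qed

text \<open>Up to position 0 the ascents are automatic, so \<open>w\<close> increases by at least 1
  per step on all integers; between the fixed points 0 and n+1 this leaves no freedom.\<close>

lemma no_descent_imp_id: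
  assumes w: "w \<in> S_inf" and asc: "\<And>i. i > 0 \<Longrightarrow> w i < w (i + 1)"
  shows "w = id"
proof -
  have "w i < w (i + 1)" for i
    using asc[of i] S_infD(4)[OF w] S_inf_pos[OF w, of 1] by (cases "i > 0"; cases "i = 0") auto
  then have step: "w i + int k \<le> w (i + int k)" for i k
  proof (induction k)
    case (Suc k)
    then show ?case
      using Suc.prems[of "i + int k"] Suc.IH by (simp add: algebra_simps)
  qed simp
  obtain n :: nat where n: "w \<in> S_fin (int n)"
    using w S_inf_imp_S_fin by blast
  have "w p = p" for p
  proof (cases "0 < p \<and> p \<le> int n")
    case True
    then have "w 0 + p \<le> w p" "w p + (int n + 1 - p) \<le> w (int n + 1)"
      using step[of 0 "nat p"] step[of p "nat (int n + 1 - p)"] by simp_all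
    then show ?thesis
      using S_infD(4)[OF w, of 0] S_finD(2)[OF n, of "int n + 1"] by simp
  next
    case False
    then show ?thesis
      using S_infD(4)[OF w] S_finD(2)[OF n] by force
  qed
  then show ?thesis
    by auto
qed

lemma S_inf_induct [consumes 1, case_names id step]:
  assumes "w \<in> S_inf" "P id"
    and step: "\<And>v i. v \<in> S_inf \<Longrightarrow> i > 0 \<Longrightarrow> v i < v (i + 1) \<Longrightarrow> P v \<Longrightarrow> P (v \<circ> simple_refl i)"
  shows "P w"
  using assms(1)
proof (induction "perm_length w" arbitrary: w rule: less_induct)
  case less
  show ?case
  proof (cases "w = id")
    case False
    then obtain i where i: "i > 0" "w (i + 1) < w i"
      using no_descent_imp_id[OF less.prems] S_inf_neq_Suc[OF less.prems]
      by (metis linorder_neqE)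
    define v where "v = w \<circ> simple_refl i"
    have "P (v \<circ> simple_refl i)"
      using less i perm_length_descent[of w i] by (intro step) (auto simp: v_def)
    then show ?thesis
      by (simp add: v_def)
  qed (use assms in simp)
qed

section \<open>The Demazure product\<close>

definition dem_right :: "int \<Rightarrow> (int \<Rightarrow> int) \<Rightarrow> (int \<Rightarrow> int)" where
  "dem_right i w = (if w i < w (i + 1) then w \<circ> simple_refl i else w)"

definition dem_left :: "int \<Rightarrow> (int \<Rightarrow> int) \<Rightarrow> (int \<Rightarrow> int)" where
  "dem_left i w = (if inv w i < inv w (i + 1) then simple_refl i \<circ> w else w)"

lemma dem_right_in_S_inf [simp]: "w \<in> S_inf \<Longrightarrow> i > 0 \<Longrightarrow> dem_right i w \<in> S_inf"
  by (simp add: dem_right_def)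

lemma dem_left_in_S_inf [simp]: "w \<in> S_inf \<Longrightarrow> i > 0 \<Longrightarrow> dem_left i w \<in> S_inf"
  by (simp add: dem_left_def)

lemma inv_apply_eq_iff: "w \<in> S_inf \<Longrightarrow> inv w a = b \<longleftrightarrow> w b = a"
  using S_infD(1) by (metis bij_inv_eq_iff)

lemma simple_refl_comp_commute:
  assumes "w \<in> S_inf" "{w j, w (j + 1)} = {i, i + 1}"
  shows "simple_refl i \<circ> w = w \<circ> simple_refl j"
proof -
  have "{inv w i, inv w (i + 1)} = {j, j + 1}"
    using assms(2) inv_apply_eq_iff[OF assms(1)] by (metis doubleton_eq_iff)
  then have "transpose (inv w i) (inv w (i + 1)) = simple_refl j"
    by (metis doubleton_eq_iff transpose_commute)
  then show ?thesis
    using transpose_comp_eq[OF S_infD(1)[OF assms(1)], of i "i + 1"] by simp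
qed

text \<open>If \<open>w\<close> sends {j, j+1} to {i, i+1}, then s_i w = w s_j, and both orders give
  the longer of \<open>w\<close> and \<open>w s_j\<close>. Otherwise multiplying on one side does
  not affect the ascent condition on the other.\<close>

lemma dem_left_right_commute:
  assumes w: "w \<in> S_inf" and "i > 0" "j > 0"
  shows "dem_left i (dem_right j w) = dem_right j (dem_left i w)"
proof (cases "{w j, w (j + 1)} = {i, i + 1}")
  case True
  have eq: "simple_refl i \<circ> w = w \<circ> simple_refl j"
    using simple_refl_comp_commute[OF w True] .
  have eq': "simple_refl i \<circ> (w \<circ> simple_refl j) = w"
    by (simp add: comp_assoc[symmetric] eq)
  consider "w j = i" "w (j + 1) = i + 1" | "w j = i + 1" "w (j + 1) = i"
    using True by (auto simp: doubleton_eq_iff)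
  then show ?thesis
  proof cases
    case 1
    then have "inv w i = j" "inv w (i + 1) = j + 1"
      using inv_apply_eq_iff[OF w] by auto
    moreover have "inv (w \<circ> simple_refl j) = simple_refl j \<circ> inv w"
      using w assms by (simp add: inv_comp_S_inf)
    ultimately show ?thesis
      using 1 by (simp add: dem_left_def dem_right_def eq)
  next
    case 2
    then have "inv w i = j + 1" "inv w (i + 1) = j"
      using inv_apply_eq_iff[OF w] by auto
    then show ?thesis
      using 2 by (simp add: dem_left_def dem_right_def)
  qed
next
  case False
  have "inv (w \<circ> simple_refl j) = simple_refl j \<circ> inv w"
    using w assms by (simp add: inv_comp_S_inf)
  moreover have "simple_refl j (inv w i) < simple_refl j (inv w (i + 1)) \<longleftrightarrow> inv w i < inv w (i + 1)"
  proof -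
    have "\<not> (inv w i = j \<and> inv w (i + 1) = j + 1)" "\<not> (inv w i = j + 1 \<and> inv w (i + 1) = j)"
      using False by (auto simp: inv_apply_eq_iff[OF w])
    moreover have "inv w i \<noteq> inv w (i + 1)"
      using S_inf_neq_Suc w by simp
    ultimately show ?thesis
      by (auto simp: transpose_def)
  qed
  moreover have "simple_refl i (w j) < simple_refl i (w (j + 1)) \<longleftrightarrow> w j < w (j + 1)"
  proof -
    have "w j \<noteq> w (j + 1)"
      using S_inf_neq_Suc w by simp
    then show ?thesis
      using False by (auto simp: transpose_def)
  qed
  ultimately show ?thesis
    by (simp add: dem_left_def dem_right_def comp_assoc)
qed

section \<open>Words acting by Demazure multiplication on the right\<close>

abbreviation dem_word :: "int list \<Rightarrow> (int \<Rightarrow> int) \<Rightarrow> (int \<Rightarrow> int)" where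
  "dem_word \<equiv> fold dem_right"

lemma dem_word_in_S_inf: "w \<in> S_inf \<Longrightarrow> \<forall>i\<in>set is. i > 0 \<Longrightarrow> dem_word is w \<in> S_inf"
  by (induction "is" arbitrary: w) auto

lemma dem_word_dem_left:
  "w \<in> S_inf \<Longrightarrow> \<forall>i\<in>set is. i > 0 \<Longrightarrow> j > 0 \<Longrightarrow> dem_word is (dem_left j w) = dem_left j (dem_word is w)"
  by (induction "is" arbitrary: w) (auto simp: dem_left_right_commute[symmetric])

lemma dem_word_exists:
  assumes "w \<in> S_inf"
  shows "\<exists>is. (\<forall>i\<in>set is. i > 0) \<and> dem_word is id = w"
  using assms
proof (induction rule: S_inf_induct)
  case id
  show ?case
    by (rule exI[of _ "[]"]) simp
next
  case (step v i)
  then obtain "is" where "\<forall>i\<in>set is. i > 0" "dem_word is id = v"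
    by blast
  then have "\<forall>j\<in>set (is @ [i]). j > 0" "dem_word (is @ [i]) id = v \<circ> simple_refl i"
    using step.hyps by (simp_all add: dem_right_def)
  then show ?case
    by blast
qed

lemma S_inf_left_induct [consumes 1, case_names id step]:
  assumes "w \<in> S_inf" "P id"
    and step: "\<And>v i. v \<in> S_inf \<Longrightarrow> i > 0 \<Longrightarrow> P v \<Longrightarrow> P (dem_left i v)"
  shows "P w"
proof -
  have "P (inv u)" if "u \<in> S_inf" for u
    using that
  proof (induction rule: S_inf_induct)
    case (step v i)
    have "inv (v \<circ> simple_refl i) = simple_refl i \<circ> inv v"
      using step by (simp add: inv_comp_S_inf)
    also have "\<dots> = dem_left i (inv v)"
      using step by (simp add: dem_left_def)
    finally show ?case
      using step assms(3)[of "inv v" i] by (simp only: inv_in_S_inf)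
  qed (simp only: inv_id assms(2))
  from this[of "inv w"] show ?thesis
    using assms(1) by simp
qed

text \<open>Every element is obtained from \<open>id\<close> by operators \<^const>\<open>dem_left\<close>, which commute with
  the action of words; so a word acts in a way that depends only on its value at \<open>id\<close>.\<close>

lemma dem_word_cong:
  assumes "\<forall>i\<in>set is. i > 0" "\<forall>i\<in>set js. i > 0" "dem_word is id = dem_word js id" "u \<in> S_inf"
  shows "dem_word is u = dem_word js u"
  using assms(4)
proof (induction rule: S_inf_left_induct)
  case (step v i)
  then show "dem_word is (dem_left i v) = dem_word js (dem_left i v)"
    using assms by (simp add: dem_word_dem_left)
qed (rule assms(3))

definition red_word :: "(int \<Rightarrow> int) \<Rightarrow> int list" where
  "red_word w = (SOME is. (\<forall>i\<in>set is. i > 0) \<and> dem_word is id = w)"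

lemma red_word:
  assumes "w \<in> S_inf"
  shows "\<forall>i\<in>set (red_word w). i > 0" "dem_word (red_word w) id = w"
  using someI_ex[OF dem_word_exists[OF assms]] unfolding red_word_def by blast+

text \<open>D u v is obtained by letting a word of \<open>v\<close> act on \<open>u\<close>; by
  \<open>dem_word_cong\<close> the choice of word does not matter. Associativity becomes
  concatenation of words, and the rule for s_i on the left is
  \<open>dem_word_dem_left\<close>.\<close>

lemma demazure_product_exists: "\<exists>D. is_demazure_product D"
proof -
  define D where "D = restrict (\<lambda>u. restrict (\<lambda>v. dem_word (red_word v) u) S_inf) S_inf"
  have D: "D u (dem_word is id) = dem_word is u" if "u \<in> S_inf" "\<forall>i\<in>set is. i > 0" for u "is"
  proof -
    have w: "dem_word is id \<in> S_inf"
      using that dem_word_in_S_inf by simp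
    then have "D u (dem_word is id) = dem_word (red_word (dem_word is id)) u"
      using that by (simp add: D_def)
    also have "\<dots> = dem_word is u"
      by (rule dem_word_cong[OF red_word(1)[OF w] that(2) red_word(2)[OF w] that(1)])
    finally show ?thesis .
  qed
  have D_word: "D u v = dem_word (red_word v) u" if "u \<in> S_inf" "v \<in> S_inf" for u v
    using that by (simp add: D_def)
  have closed: "D u v \<in> S_inf" if "u \<in> S_inf" "v \<in> S_inf" for u v
    using that D_word dem_word_in_S_inf red_word by simp
  have right: "D w (simple_refl i) = dem_right i w" if "w \<in> S_inf" "i > 0" for w i
    using D[of w "[i]"] that by (simp add: dem_right_def)
  have id_left: "D id w = w" if "w \<in> S_inf" for w
    using that D_word red_word by simp
  have left: "D (simple_refl i) w = dem_left i w" if "w \<in> S_inf" "i > 0" for w i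
  proof -
    have "D (simple_refl i) w = dem_word (red_word w) (dem_left i id)"
      using that D_word by (simp add: dem_left_def)
    also have "\<dots> = dem_left i w"
      using that red_word[of w] by (simp add: dem_word_dem_left)
    finally show ?thesis .
  qed
  have assoc: "D (D u v) w = D u (D v w)" if "u \<in> S_inf" "v \<in> S_inf" "w \<in> S_inf" for u v w
  proof -
    have "D v w = dem_word (red_word v @ red_word w) id"
      using that red_word D_word by simp
    then have "D u (D v w) = dem_word (red_word v @ red_word w) u"
      using that red_word by (metis D UnE set_append)
    then show ?thesis
      using that D_word closed by simp
  qed
  have "D \<in> S_inf \<rightarrow>\<^sub>E (S_inf \<rightarrow>\<^sub>E S_inf)"
    using closed unfolding D_def by (auto simp: PiE_def Pi_def)
  then have "is_demazure_product D"
    using assoc left right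
    by (simp add: is_demazure_product_def perm_length_less_iff perm_length_less_iff_left
        dem_left_def dem_right_def)
  then show ?thesis
    by (rule exI[of _ D])
qed

section \<open>Uniqueness of the Demazure product\<close>

lemma is_demazure_productD:
  assumes "is_demazure_product D"
  shows "u \<in> S_inf \<Longrightarrow> v \<in> S_inf \<Longrightarrow> D u v \<in> S_inf"
    and "u \<in> S_inf \<Longrightarrow> v \<in> S_inf \<Longrightarrow> w \<in> S_inf \<Longrightarrow> D (D u v) w = D u (D v w)"
    and "w \<in> S_inf \<Longrightarrow> i > 0 \<Longrightarrow> D (simple_refl i) w = dem_left i w"
    and "w \<in> S_inf \<Longrightarrow> i > 0 \<Longrightarrow> D w (simple_refl i) = dem_right i w"
  using assms
  by (auto simp: is_demazure_product_def perm_length_less_iff perm_length_less_iff_left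
        dem_left_def dem_right_def PiE_def Pi_def)

text \<open>The defining rules only describe products with a simple reflection, so the identity law
  has to be derived from them.\<close>

lemma is_demazure_product_id_left:
  assumes D: "is_demazure_product D" and "w \<in> S_inf"
  shows "D id w = w"
  using assms(2)
proof (induction rule: S_inf_induct)
  case id
  define e where "e = D id id"
  have e: "e \<in> S_inf"
    using is_demazure_productD(1)[OF D] by (simp add: e_def)
  have "dem_right i e = simple_refl i" if "i > 0" for i
  proof -
    have "dem_right i e = D (D id id) (simple_refl i)"
      using is_demazure_productD(4)[OF D e that] by (simp add: e_def)
    also have "\<dots> = D id (D id (simple_refl i))"
      using that by (simp add: is_demazure_productD(2)[OF D])
    also have "\<dots> = simple_refl i"
      using that is_demazure_productD(4)[OF D, of id i] by (simp add: dem_right_def)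
    finally show ?thesis .
  qed
  then have e_cases: "e = id \<or> e = simple_refl i" if "i > 0" for i
    using that unfolding dem_right_def
    by (metis comp_simple_refl_eq_iff transpose_comp_involutory)
  \<comment> \<open>If \<open>e\<close> were not \<open>id\<close>, it would equal both s_1 and s_2,
    which differ at 2.\<close>
  have "simple_refl 1 2 \<noteq> (simple_refl 2 2 :: int)"
    by (simp add: transpose_def)
  then have "simple_refl 1 \<noteq> simple_refl 2"
    by metis
  then show "D id id = id"
    using e_cases[of 1] e_cases[of 2] by (auto simp: e_def)
next
  case (step v i)
  have "v \<circ> simple_refl i = D v (simple_refl i)"
    using step is_demazure_productD(4)[OF D] by (simp add: dem_right_def)
  moreover have "D id v = v"
    by (rule step.IH)
  ultimately show "D id (v \<circ> simple_refl i) = v \<circ> simple_refl i"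
    using step.hyps is_demazure_productD(2)[OF D, of id v "simple_refl i"] by simp
qed

text \<open>By associativity, simple reflections peeled off the right of the first factor move onto
  the second, until the first is \<open>id\<close>.\<close>

lemma is_demazure_product_unique:
  assumes D: "is_demazure_product D" and D': "is_demazure_product D'"
  shows "D = D'"
proof -
  have eq: "D u v = D' u v" if "u \<in> S_inf" "v \<in> S_inf" for u v
    using that
  proof (induction arbitrary: v rule: S_inf_induct)
    case id
    then show "D id v = D' id v"
      using is_demazure_product_id_left[OF D] is_demazure_product_id_left[OF D'] by simp
  next
    case (step u i)
    have "E (u \<circ> simple_refl i) v = E u (dem_left i v)" if E: "is_demazure_product E" for E
    proof -
      have "u \<circ> simple_refl i = E u (simple_refl i)"
        using step is_demazure_productD(4)[OF E] by (simp add: dem_right_def)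
      then show ?thesis
        using step is_demazure_productD(2,3)[OF E] by simp
    qed
    then show "D (u \<circ> simple_refl i) v = D' (u \<circ> simple_refl i) v"
      using step D D' by simp
  qed
  have ext: "D \<in> S_inf \<rightarrow>\<^sub>E (S_inf \<rightarrow>\<^sub>E S_inf)" "D' \<in> S_inf \<rightarrow>\<^sub>E (S_inf \<rightarrow>\<^sub>E S_inf)"
    using D D' by (simp_all add: is_demazure_product_def)
  have "D u = D' u" if "u \<in> S_inf" for u
    by (rule PiE_ext[of _ S_inf "\<lambda>_. S_inf"]) (use ext eq that in auto)
  then show ?thesis
    by (intro PiE_ext[OF ext]) auto
qed

lemma demazure: "is_demazure_product demazure"
proof -
  obtain D where D: "is_demazure_product D"
    using demazure_product_exists by blast
  then have "demazure = D"
    unfolding demazure_def using is_demazure_product_unique by (intro the_equality) auto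
  with D show ?thesis
    by simp
qed

lemmas demazure_closed = is_demazure_productD(1)[OF demazure]
  and demazure_assoc = is_demazure_productD(2)[OF demazure]
  and demazure_simple_left = is_demazure_productD(3)[OF demazure]
  and demazure_simple_right = is_demazure_productD(4)[OF demazure]
  and demazure_id_left = is_demazure_product_id_left[OF demazure]

section \<open>Involutions\<close>

lemma involution_inv: "y \<circ> y = id \<Longrightarrow> inv y = y"
  by (rule inv_unique_comp)

lemma involution_apply: "y \<circ> y = id \<Longrightarrow> y (y a) = a"
  by (metis comp_apply id_apply)

lemma involution_conj:
  assumes "y \<circ> y = id"
  shows "(simple_refl i \<circ> y \<circ> simple_refl i) \<circ> (simple_refl i \<circ> y \<circ> simple_refl i) = id"
  using assms by (auto simp: fun_eq_iff)

lemma involution_comp_simple_refl: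
  assumes "y \<in> S_inf" "y \<circ> y = id" "{y i, y (i + 1)} = {i, i + 1}"
  shows "(y \<circ> simple_refl i) \<circ> (y \<circ> simple_refl i) = id"
proof -
  have "(y \<circ> simple_refl i) \<circ> (y \<circ> simple_refl i) = y \<circ> (simple_refl i \<circ> y) \<circ> simple_refl i"
    by (simp add: comp_assoc)
  also have "\<dots> = id"
    using assms by (simp add: simple_refl_comp_commute comp_assoc[symmetric])
  finally show ?thesis .
qed

text \<open>Two-sided Demazure multiplication by s_i: the effect of lengthening \<open>w\<close> to
  \<open>w s_i\<close> on the Demazure product of \<open>w^-1\<close> and \<open>w\<close>.\<close>

definition dem_conj :: "int \<Rightarrow> (int \<Rightarrow> int) \<Rightarrow> (int \<Rightarrow> int)" where
  "dem_conj i y = dem_left i (dem_right i y)"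

lemma dem_conj_descent:
  assumes "y \<circ> y = id" "y (i + 1) < y i"
  shows "dem_conj i y = y"
  using assms by (simp add: dem_conj_def dem_left_def dem_right_def involution_inv)

text \<open>Once y s_i is formed, s_i on the left still lengthens it, unless \<open>y\<close> fixes
  both i and i+1; then y s_i = s_i y already absorbs s_i.\<close>

lemma dem_conj_ascent:
  assumes y: "y \<in> S_inf" "y \<circ> y = id" and i: "i > 0" and asc: "y i < y (i + 1)"
  shows "dem_conj i y = (if y i = i \<and> y (i + 1) = i + 1 then y \<circ> simple_refl i
    else simple_refl i \<circ> y \<circ> simple_refl i)"
proof -
  have "inv (y \<circ> simple_refl i) = simple_refl i \<circ> y"
    using y i by (simp add: inv_comp_S_inf involution_inv)
  moreover have "simple_refl i (y i) < simple_refl i (y (i + 1)) \<longleftrightarrow> \<not> (y i = i \<and> y (i + 1) = i + 1)"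
    using asc by (auto simp: transpose_def)
  ultimately show ?thesis
    using asc by (simp add: dem_conj_def dem_left_def dem_right_def comp_assoc)
qed

lemma dem_conj_involution:
  assumes y: "y \<in> S_inf" "y \<circ> y = id" and i: "i > 0"
  shows "dem_conj i y \<in> S_inf" "dem_conj i y \<circ> dem_conj i y = id"
    "dem_conj i y (i + 1) < dem_conj i y i"
proof -
  show "dem_conj i y \<in> S_inf"
    using y i by (simp add: dem_conj_def)
  have "dem_conj i y \<circ> dem_conj i y = id \<and> dem_conj i y (i + 1) < dem_conj i y i"
  proof (cases "y i < y (i + 1)")
    case asc: True
    show ?thesis
    proof (cases "y i = i \<and> y (i + 1) = i + 1")
      case True
      then show ?thesis
        using dem_conj_ascent[OF assms asc] involution_comp_simple_refl[OF y] by simp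
    next
      case False
      then have "simple_refl i (y i) < simple_refl i (y (i + 1))"
        using asc by (auto simp: transpose_def)
      moreover have "dem_conj i y = simple_refl i \<circ> y \<circ> simple_refl i"
        using dem_conj_ascent[OF assms asc] False by auto
      ultimately show ?thesis
        using involution_conj[OF y(2)] by simp
    qed
  next
    case False
    then have "y (i + 1) < y i"
      using S_inf_neq_Suc[OF y(1), of i] by simp
    then show ?thesis
      using dem_conj_descent[OF y(2)] y by simp
  qed
  then show "dem_conj i y \<circ> dem_conj i y = id" "dem_conj i y (i + 1) < dem_conj i y i"
    by auto
qed

text \<open>The inverse of \<open>dem_conj i\<close>, from involutions with a descent at i to
  involutions with an ascent there. Its branches are the two descent cases of the theorem.\<close>

definition lower_conj :: "int \<Rightarrow> (int \<Rightarrow> int) \<Rightarrow> (int \<Rightarrow> int)" where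
  "lower_conj i z = (if z i = i + 1 then z \<circ> simple_refl i else simple_refl i \<circ> z \<circ> simple_refl i)"

lemma lower_conj:
  assumes z: "z \<in> S_inf" "z \<circ> z = id" and i: "i > 0" and desc: "z (i + 1) < z i"
  shows "lower_conj i z \<in> S_inf" "lower_conj i z \<circ> lower_conj i z = id"
    "lower_conj i z i < lower_conj i z (i + 1)" "dem_conj i (lower_conj i z) = z"
proof -
  let ?y = "lower_conj i z" and ?s = "simple_refl i"
  show y: "?y \<in> S_inf"
    using z i by (simp add: lower_conj_def)
  have "?y \<circ> ?y = id \<and> ?y i < ?y (i + 1) \<and> dem_conj i ?y = z"
  proof (cases "z i = i + 1")
    case True
    have "z (i + 1) = i"
      using involution_apply[OF z(2), of i] True by simp
    then have "?y \<circ> ?y = id" "?y i = i" "?y (i + 1) = i + 1"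
      using True involution_comp_simple_refl[OF z, of i] by (auto simp: lower_conj_def)
    then show ?thesis
      using dem_conj_ascent[OF y _ i] True by (simp add: lower_conj_def)
  next
    case False
    then have eq: "?y = ?s \<circ> z \<circ> ?s"
      by (simp add: lower_conj_def)
    have inv: "?y \<circ> ?y = id"
      using involution_conj[OF z(2)] eq by simp
    moreover have "?s (z (i + 1)) < ?s (z i)"
      using desc False by (auto simp: transpose_def)
    then have asc: "?y i < ?y (i + 1)"
      by (simp add: eq)
    moreover have "\<not> (?y i = i \<and> ?y (i + 1) = i + 1)"
      using desc by (auto simp: eq transpose_def split: if_splits)
    then have "dem_conj i ?y = ?s \<circ> ?y \<circ> ?s"
      using dem_conj_ascent[OF y inv i asc] by auto
    then have "dem_conj i ?y = z"
      by (simp add: eq fun_eq_iff)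
    ultimately show ?thesis
      by blast
  qed
  then show "?y \<circ> ?y = id" "?y i < ?y (i + 1)" "dem_conj i ?y = z"
    by auto
qed

lemma lower_conj_dem_conj:
  assumes y: "y \<in> S_inf" "y \<circ> y = id" and i: "i > 0" and asc: "y i < y (i + 1)"
  shows "lower_conj i (dem_conj i y) = y"
proof (cases "y i = i \<and> y (i + 1) = i + 1")
  case True
  then show ?thesis
    using dem_conj_ascent[OF assms] by (simp add: lower_conj_def)
next
  case False
  then have eq: "dem_conj i y = simple_refl i \<circ> y \<circ> simple_refl i"
    using dem_conj_ascent[OF assms] by auto
  \<comment> \<open>Otherwise y i = i+1, which is a descent at i. It follows that the conjugate
    falls under the second branch of \<open>lower_conj\<close>.\<close>
  have "y (i + 1) \<noteq> i"
    using asc involution_apply[OF y(2), of "i + 1"] by auto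
  then have "dem_conj i y i \<noteq> i + 1"
    by (auto simp: eq transpose_def)
  then show ?thesis
    by (simp add: lower_conj_def eq fun_eq_iff)
qed

text \<open>The sum that is halved grows by two. If \<open>y\<close> fixes i and i+1, the length and
  the number of 2-cycles grow by one each; otherwise the length grows by two and conjugation keeps
  the number of 2-cycles.\<close>

lemma inv_length_dem_conj:
  assumes y: "y \<in> S_inf" "y \<circ> y = id" and i: "i > 0" and asc: "y i < y (i + 1)"
  shows "inv_length (dem_conj i y) = Suc (inv_length y)"
proof -
  let ?s = "simple_refl i" and ?E = "\<lambda>y. {a. 0 < a \<and> a < y a} :: int set"
  show ?thesis
  proof (cases "y i = i \<and> y (i + 1) = i + 1")
    case True
    have "finite (?E y)"
      by (rule finite_subset[OF _ S_infD(5)[OF y(1)]]) auto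
    moreover have "?E (y \<circ> ?s) = insert i (?E y)"
      using True i by (auto simp: transpose_def split: if_splits)
    ultimately have "card (?E (y \<circ> ?s)) = Suc (card (?E y))"
      using True by simp
    then show ?thesis
      using dem_conj_ascent[OF assms] True perm_length_ascent[OF y(1) asc] by (simp add: inv_length_def)
  next
    case False
    then have eq: "dem_conj i y = ?s \<circ> y \<circ> ?s"
      using dem_conj_ascent[OF assms] by auto
    have ne: "y i \<noteq> i + 1" "y (i + 1) \<noteq> i"
      using asc involution_apply[OF y(2), of i] involution_apply[OF y(2), of "i + 1"] by auto
    have "bij_betw ?s (?E y) (?E (?s \<circ> y \<circ> ?s))"
    proof (rule bij_betw_byWitness[where f' = ?s])
      show "?s ` ?E y \<subseteq> ?E (?s \<circ> y \<circ> ?s)"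
        using i ne by (auto simp: transpose_def)
      show "?s ` ?E (?s \<circ> y \<circ> ?s) \<subseteq> ?E y"
        using i ne by (auto simp: transpose_def split: if_splits)
    qed simp_all
    then have card: "card (?E (?s \<circ> y \<circ> ?s)) = card (?E y)"
      by (rule bij_betw_same_card[symmetric])
    have "inv (?s \<circ> y) = y \<circ> ?s"
      using y i by (simp add: inv_comp_S_inf involution_inv)
    then have "perm_length (?s \<circ> y) = Suc (perm_length y)"
      using perm_length_inv[of "?s \<circ> y"] perm_length_ascent[OF y(1) asc] y i by simp
    moreover have "(?s \<circ> y) i < (?s \<circ> y) (i + 1)"
      using asc False by (auto simp: transpose_def)
    ultimately have "perm_length (?s \<circ> y \<circ> ?s) = Suc (Suc (perm_length y))"
      using perm_length_ascent[of "?s \<circ> y" i] y i by simp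
    then show ?thesis
      using card by (simp add: inv_length_def eq)
  qed
qed

lemma inv_length_dem_conj_le:
  assumes y: "y \<in> S_inf" "y \<circ> y = id" and i: "i > 0"
  shows "inv_length (dem_conj i y) \<le> Suc (inv_length y)"
  using inv_length_dem_conj[OF assms] dem_conj_descent[OF y(2)] S_inf_neq_Suc[OF y(1), of i]
  by (metis le_Suc_eq linorder_neqE order_refl)

text \<open>\<open>dem_conj i y\<close> descends at i, but elements of \<open>S_fin n\<close> ascend
  from position n on. So i < n, and \<open>y\<close> is recovered inside
  \<open>S_fin n\<close>.\<close>

lemma dem_conj_S_finD:
  assumes y: "y \<in> S_inf" "y \<circ> y = id" and i: "i > 0" and fin: "dem_conj i y \<in> S_fin n"
  shows "i < n" "y \<in> S_fin n"
proof -
  show "i < n"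
    using S_fin_ascent[OF fin, of i] dem_conj_involution(3)[OF y i] by linarith
  then have s: "simple_refl i \<in> S_fin n"
    using i by simp
  show "y \<in> S_fin n"
  proof (cases "y i < y (i + 1)")
    case True
    have "lower_conj i (dem_conj i y) \<in> S_fin n"
      using s fin by (simp add: lower_conj_def)
    then show ?thesis
      using lower_conj_dem_conj[OF y i True] by simp
  next
    case False
    then show ?thesis
      using dem_conj_descent[OF y(2)] S_inf_neq_Suc[OF y(1), of i] fin by simp
  qed
qed

section \<open>The sets of Hecke atoms of an involution\<close>

definition dem_square :: "(int \<Rightarrow> int) \<Rightarrow> (int \<Rightarrow> int)" where
  "dem_square w = demazure (inv w) w"

lemma dem_square_id: "dem_square id = id"
  by (simp only: dem_square_def inv_id demazure_id_left id_in_S_inf)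

text \<open>The ascent makes \<open>v s_i\<close> and its inverse Demazure products with s_i;
  associativity then moves both factors s_i to the outside.\<close>

lemma dem_square_step:
  assumes "v \<in> S_inf" "i > 0" "v i < v (i + 1)"
  shows "dem_square (v \<circ> simple_refl i) = dem_conj i (dem_square v)"
proof -
  let ?s = "simple_refl i"
  have s: "?s \<in> S_inf" and v: "inv v \<in> S_inf"
    using assms by simp_all
  have 1: "inv (v \<circ> ?s) = demazure ?s (inv v)"
    using assms by (simp add: demazure_simple_left dem_left_def inv_comp_S_inf)
  have 2: "v \<circ> ?s = demazure v ?s"
    using assms by (simp add: demazure_simple_right dem_right_def)
  have "dem_square (v \<circ> ?s) = demazure (demazure ?s (inv v)) (demazure v ?s)"
    unfolding dem_square_def 1 by (simp only: 2)
  also have "\<dots> = demazure ?s (demazure (demazure (inv v) v) ?s)"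
    using s v assms(1) by (simp only: demazure_assoc demazure_closed)
  also have "\<dots> = dem_conj i (dem_square v)"
    using assms v by (simp add: demazure_simple_left demazure_simple_right demazure_closed
        dem_conj_def dem_square_def)
  finally show ?thesis .
qed

lemma dem_square_involution:
  assumes "w \<in> S_inf"
  shows "dem_square w \<in> S_inf" "dem_square w \<circ> dem_square w = id"
proof -
  have "dem_square w \<in> S_inf \<and> dem_square w \<circ> dem_square w = id"
    using assms
  proof (induction rule: S_inf_induct)
    case id
    show "dem_square id \<in> S_inf \<and> dem_square id \<circ> dem_square id = id"
      by (simp add: dem_square_id)
  next
    case (step v i)
    then show ?case
      unfolding dem_square_step[OF step.hyps] using dem_conj_involution[of "dem_square v" i] by blast
  qed
  then show "dem_square w \<in> S_inf" "dem_square w \<circ> dem_square w = id"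
    by auto
qed

lemma dem_square_descent:
  assumes "w \<in> S_inf" "i > 0" "w (i + 1) < w i"
  shows "dem_square w = dem_conj i (dem_square (w \<circ> simple_refl i))"
  using dem_square_step[of "w \<circ> simple_refl i" i] assms by simp

text \<open>Each letter of a reduced word for \<open>w\<close> raises \<open>inv_length\<close> by
  at most one. This keeps the exponents of beta from truncating.\<close>

lemma inv_length_dem_square_le:
  assumes "w \<in> S_inf"
  shows "inv_length (dem_square w) \<le> perm_length w"
  using assms
proof (induction rule: S_inf_induct)
  case id
  have "{a. 0 < a \<and> a < (id a :: int)} = {}"
    by auto
  then have "inv_length id = 0"
    by (simp only: inv_length_def card.empty perm_length_id)
  then show "inv_length (dem_square id) \<le> perm_length id"
    by (simp add: dem_square_id)
next
  case (step v i)
  have "inv_length (dem_square (v \<circ> simple_refl i)) \<le> Suc (inv_length (dem_square v))"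
    unfolding dem_square_step[OF step.hyps]
    by (rule inv_length_dem_conj_le) (use step dem_square_involution in auto)
  also have "\<dots> \<le> perm_length (v \<circ> simple_refl i)"
    using step.IH perm_length_ascent[OF step.hyps(1,3)] by simp
  finally show ?case .
qed

text \<open>Undoing the letters of \<open>w\<close> one at a time never leaves
  \<open>S_fin n\<close>. This makes \<open>B_inv z\<close> finite.\<close>

lemma S_fin_if_dem_square_S_fin:
  assumes "w \<in> S_inf" "dem_square w \<in> S_fin n"
  shows "w \<in> S_fin n"
  using assms
proof (induction rule: S_inf_induct)
  case id
  show ?case
    by (rule id_in_S_fin)
next
  case (step v i)
  have "dem_conj i (dem_square v) \<in> S_fin n"
    using step.prems by (simp only: dem_square_step[OF step.hyps])
  then have "i < n" "dem_square v \<in> S_fin n"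
    using dem_conj_S_finD[OF dem_square_involution[OF step.hyps(1)] step.hyps(2)] by blast+
  then show ?case
    by (intro comp_in_S_fin step.IH simple_refl_in_S_fin step.hyps(2))
qed

lemma B_inv_iff: "w \<in> B_inv z \<longleftrightarrow> w \<in> S_inf \<and> dem_square w = z"
  by (simp add: B_inv_def dem_square_def)

lemma finite_B_inv:
  assumes "z \<in> S_inf"
  shows "finite (B_inv z)"
proof -
  obtain n :: nat where "z \<in> S_fin (int n)"
    using S_inf_imp_S_fin[OF assms] .
  then have "B_inv z \<subseteq> S_fin (int n)"
    using S_fin_if_dem_square_S_fin by (auto simp: B_inv_iff)
  then show ?thesis
    using finite_S_fin finite_subset by blast
qed

lemma B_inv_ascent:
  assumes "w \<in> B_inv z" "i > 0" "z i < z (i + 1)"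
  shows "w i < w (i + 1)"
proof (rule ccontr)
  assume "\<not> w i < w (i + 1)"
  moreover have w: "w \<in> S_inf" "dem_square w = z"
    using assms(1) by (simp_all add: B_inv_iff)
  ultimately have "w (i + 1) < w i"
    using S_inf_neq_Suc[OF w(1), of i] by simp
  then have z: "z = dem_conj i (dem_square (w \<circ> simple_refl i))"
    using dem_square_descent assms(2) w by auto
  have "z (i + 1) < z i"
    unfolding z by (rule dem_conj_involution(3)) (use w assms(2) dem_square_involution in simp_all)
  then show False
    using assms(3) by simp
qed

text \<open>An atom with a descent at i is v s_i with \<open>v\<close> ascending there, and
  \<open>dem_conj i\<close> maps the involution of \<open>v\<close> to \<open>z\<close>. If that
  involution ascends at i, it is \<open>lower_conj i z\<close>; if it descends, it is
  \<open>z\<close>, and \<open>v\<close> lies in \<open>N\<close>.\<close>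

lemma B_inv_descent_eq:
  assumes z: "z \<in> S_inf" "z \<circ> z = id" and i: "i > 0" and desc: "z (i + 1) < z i"
  defines "N \<equiv> {v \<in> B_inv z. v i < v (i + 1)}"
  shows "B_inv z = N \<union> (\<lambda>v. v \<circ> simple_refl i) ` (N \<union> B_inv (lower_conj i z))"
    (is "_ = _ \<union> ?r ` (_ \<union> B_inv ?y)")
proof (intro equalityI subsetI)
  fix w assume w: "w \<in> B_inv z"
  then have wS: "w \<in> S_inf" "dem_square w = z"
    by (simp_all add: B_inv_iff)
  show "w \<in> N \<union> ?r ` (N \<union> B_inv ?y)"
  proof (cases "w i < w (i + 1)")
    case True
    then show ?thesis
      using w by (simp add: N_def)
  next
    case False
    then have "w (i + 1) < w i"
      using S_inf_neq_Suc[OF wS(1), of i] by simp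
    define v where "v = ?r w"
    have v: "v \<in> S_inf" "v i < v (i + 1)" "w = ?r v"
      using wS i \<open>w (i + 1) < w i\<close> by (simp_all add: v_def)
    let ?u = "dem_square v"
    have u: "?u \<in> S_inf" "?u \<circ> ?u = id" and z_eq: "z = dem_conj i ?u"
      using dem_square_involution[OF v(1)] dem_square_step[OF v(1) i v(2)] wS(2) v(3) by auto
    have "v \<in> N \<union> B_inv ?y"
    proof (cases "?u i < ?u (i + 1)")
      case True
      then have "?y = ?u"
        using lower_conj_dem_conj[OF u i] z_eq by simp
      then show ?thesis
        using v(1) by (simp add: B_inv_iff)
    next
      case False
      then have "?u = z"
        using dem_conj_descent[OF u(2)] S_inf_neq_Suc[OF u(1), of i] z_eq by simp
      then show ?thesis
        using v by (simp add: N_def B_inv_iff)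
    qed
    then show ?thesis
      using v(3) by blast
  qed
next
  fix w assume "w \<in> N \<union> ?r ` (N \<union> B_inv ?y)"
  then consider "w \<in> N" | v where "v \<in> N" "w = ?r v" | v where "v \<in> B_inv ?y" "w = ?r v"
    by blast
  then show "w \<in> B_inv z"
  proof cases
    case 1
    then show ?thesis
      by (simp add: N_def)
  next
    case 2
    then have "dem_square w = dem_conj i z"
      using dem_square_step[of v i] i by (simp add: N_def B_inv_iff)
    then show ?thesis
      using 2 i dem_conj_descent[OF z(2) desc] by (simp add: N_def B_inv_iff)
  next
    case 3
    then have "dem_square w = dem_conj i ?y"
      using dem_square_step[of v i] i B_inv_ascent[OF 3(1) i lower_conj(3)[OF assms(1-4)]]
      by (simp add: B_inv_iff)
    then show ?thesis
      using 3 i lower_conj(4)[OF assms(1-4)] by (simp add: B_inv_iff)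
  qed
qed

section \<open>Exchanging two variables\<close>

lemma poly_mapping_add_single_induct [case_names zero add_single]:
  fixes f :: "'a \<Rightarrow>\<^sub>0 'b::monoid_add"
  assumes "P 0" "\<And>f k v. P f \<Longrightarrow> P (f + Poly_Mapping.single k v)"
  shows "P f"
proof (induction f rule: Poly_Mapping.update_induct)
  case const
  show ?case
    by (rule assms(1))
next
  case (update f a b)
  have "Poly_Mapping.lookup f a = 0"
    using update by (simp add: in_keys_iff)
  then have "Poly_Mapping.update a b f = f + Poly_Mapping.single a b"
    by (intro poly_mapping_eqI) (auto simp: lookup_update lookup_add lookup_single when_def)
  then show ?case
    using assms(2) update by simp
qed

context
  fixes i :: int
begin

abbreviation (input) swap_key :: "(int \<Rightarrow>\<^sub>0 nat) \<Rightarrow> (int \<Rightarrow>\<^sub>0 nat)" where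
  "swap_key \<equiv> Poly_Mapping.map_key (simple_refl i)"

lemma swap_key_swap_key: "swap_key (swap_key a) = a"
  using map_key_compose[of "simple_refl i" "simple_refl i" a] map_key_id[of a]
  by (simp add: id_def)

lemma inj_swap_key: "inj swap_key"
  by (metis injI swap_key_swap_key)

lemma swap_vars_single:
  "swap_vars i (Poly_Mapping.single k v) = Poly_Mapping.single (swap_key k) v"
  using map_key_single[OF inj_swap_key, of "swap_key k" v]
  by (simp add: swap_vars_def swap_key_swap_key)

lemma swap_vars_zero [simp]: "swap_vars i 0 = 0"
  by (simp add: swap_vars_def inj_swap_key)

lemma swap_vars_add: "swap_vars i (f + g) = swap_vars i f + swap_vars i g"
  by (simp add: swap_vars_def map_key_plus inj_swap_key)

lemma swap_vars_mult: "swap_vars i (f * g) = swap_vars i f * swap_vars i g"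
proof -
  have single: "swap_vars i (Poly_Mapping.single k v * g) = swap_vars i (Poly_Mapping.single k v) * swap_vars i g"
    for k v
  proof (induction g rule: poly_mapping_add_single_induct)
    case (add_single g l u)
    then show ?case
      by (simp add: distrib_left swap_vars_add swap_vars_single mult_single map_key_plus)
  qed simp
  show ?thesis
    by (induction f rule: poly_mapping_add_single_induct) (simp_all add: distrib_right swap_vars_add single)
qed

lemma swap_vars_X: "swap_vars i (X j) = X (simple_refl i j)"
  using map_key_single[of "simple_refl i" "simple_refl i j" "1 :: nat"]
  by (simp add: X_def swap_vars_single)

lemma swap_vars_beta [simp]: "swap_vars i \<beta> = \<beta>"
  by (simp add: \<beta>_def swap_vars_single)

lemma swap_vars_one [simp]: "swap_vars i 1 = 1"
  using swap_vars_single[of 0 1] by simp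

lemma swap_vars_beta_power [simp]: "swap_vars i (\<beta> ^ n) = \<beta> ^ n"
  by (induction n) (simp_all add: swap_vars_mult)

end

text \<open>The two variables have different exponent vectors as keys. Cancelling this factor makes
  the quotient in \<open>div_diff\<close> unique.\<close>

lemma X_diff_neq_zero: "X i - X (i + 1) \<noteq> 0"
proof
  let ?e = "\<lambda>j. Poly_Mapping.single j 1 :: int \<Rightarrow>\<^sub>0 nat"
  assume "X i - X (i + 1) = 0"
  then have "Poly_Mapping.keys (X i) = Poly_Mapping.keys (X (i + 1))"
    by simp
  then have "Poly_Mapping.keys (?e i) = Poly_Mapping.keys (?e (i + 1))"
    by (simp add: X_def)
  then show False
    by simp
qed

text \<open>The relation "g is the beta divided difference of f" with the denominator cleared; the
  swap has turned 1 + beta x_(i+1) into 1 + beta x_i. In this form it passes directly to sums and to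
  multiples by powers of beta.\<close>

definition is_div_diff_beta :: "int \<Rightarrow> beta_mpoly \<Rightarrow> beta_mpoly \<Rightarrow> bool" where
  "is_div_diff_beta i f g \<longleftrightarrow>
    (X i - X (i + 1)) * g = (1 + \<beta> * X (i + 1)) * f - (1 + \<beta> * X i) * swap_vars i f"

lemma is_div_diff_betaD:
  assumes "is_div_diff_beta i f g"
  shows "div_diff_beta i f = g"
proof -
  have "(1 + \<beta> * X (i + 1)) * f - swap_vars i ((1 + \<beta> * X (i + 1)) * f) = (X i - X (i + 1)) * g"
    using assms by (simp add: is_div_diff_beta_def swap_vars_add swap_vars_mult swap_vars_X)
  then have "div_diff_beta i f = (THE g'. (X i - X (i + 1)) * g' = (X i - X (i + 1)) * g)"
    by (simp only: div_diff_beta_def div_diff_def)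
  also have "\<dots> = g"
    using X_diff_neq_zero by (intro the_equality) simp_all
  finally show ?thesis .
qed

lemma is_div_diff_beta_zero: "is_div_diff_beta i 0 0"
  by (simp add: is_div_diff_beta_def)

lemma is_div_diff_beta_add:
  "is_div_diff_beta i f g \<Longrightarrow> is_div_diff_beta i f' g' \<Longrightarrow> is_div_diff_beta i (f + f') (g + g')"
  by (simp add: is_div_diff_beta_def swap_vars_add distrib_left)

lemma is_div_diff_beta_scale:
  assumes "is_div_diff_beta i f g"
  shows "is_div_diff_beta i (\<beta> ^ n * f) (\<beta> ^ n * g)"
proof -
  have "(X i - X (i + 1)) * (\<beta> ^ n * g) = \<beta> ^ n * ((X i - X (i + 1)) * g)"
    by (simp only: mult.left_commute)
  then show ?thesis
    using assms by (simp add: is_div_diff_beta_def swap_vars_mult right_diff_distrib mult.left_commute)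
qed

lemma is_div_diff_beta_sum:
  "(\<And>a. a \<in> A \<Longrightarrow> is_div_diff_beta i (f a) (g a)) \<Longrightarrow> is_div_diff_beta i (sum f A) (sum g A)"
  by (induction A rule: infinite_finite_induct)
    (simp_all add: is_div_diff_beta_zero is_div_diff_beta_add)

section \<open>The 0-Hecke algebra\<close>

type_synonym hecke = "(int \<Rightarrow> int) \<Rightarrow> beta_mpoly"

text \<open>A function \<open>F\<close> encodes the formal sum of the \<open>F w u\<^sub>w\<close> in the algebra with
  \<open>u\<^sub>i\<^sup>2 = \<beta> u\<^sub>i\<close>, and \<open>hecke_gen i\<close> is multiplication by \<open>u\<^sub>i\<close> on the right.\<close>

definition hecke_gen :: "int \<Rightarrow> hecke \<Rightarrow> hecke" where
  "hecke_gen i F w = (if w (i + 1) < w i then F (w \<circ> simple_refl i) + \<beta> * F w else 0)"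

text \<open>Right multiplication by 1 + x u_i.\<close>

definition hecke_fac :: "int \<Rightarrow> beta_mpoly \<Rightarrow> hecke \<Rightarrow> hecke" where
  "hecke_fac i x F = (\<lambda>w. F w + x * hecke_gen i F w)"

text \<open>Right multiplication by (1 + x u_(k+d-1)) ... (1 + x u_k), the largest index coming
  first.\<close>

primrec hecke_col :: "nat \<Rightarrow> int \<Rightarrow> beta_mpoly \<Rightarrow> hecke \<Rightarrow> hecke" where
  "hecke_col 0 k x F = F"
| "hecke_col (Suc d) k x F = hecke_fac k x (hecke_col d (k + 1) x F)"

text \<open>Right multiplication by the columns in \<open>X k\<close>, ...,
  \<open>X (k + d - 1)\<close>, of lengths d, ..., 1. All of them begin with index k+d-1.\<close>

primrec hecke_prod :: "nat \<Rightarrow> int \<Rightarrow> hecke \<Rightarrow> hecke" where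
  "hecke_prod 0 k F = F"
| "hecke_prod (Suc d) k F = hecke_prod d (k + 1) (hecke_col (Suc d) k (X k) F)"

lemma hecke_gen_add: "hecke_gen i (\<lambda>w. F w + G w) = (\<lambda>w. hecke_gen i F w + hecke_gen i G w)"
  by (simp add: hecke_gen_def fun_eq_iff algebra_simps)

lemma hecke_gen_scale: "hecke_gen i (\<lambda>w. c * F w) = (\<lambda>w. c * hecke_gen i F w)"
  by (simp add: hecke_gen_def fun_eq_iff algebra_simps)

lemma hecke_gen_idem: "hecke_gen i (hecke_gen i F) = (\<lambda>w. \<beta> * hecke_gen i F w)"
  by (simp add: hecke_gen_def fun_eq_iff)

lemma hecke_gen_commute:
  assumes "i + 1 < j"
  shows "hecke_gen i (hecke_gen j F) = hecke_gen j (hecke_gen i F)"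
proof
  fix w :: "int \<Rightarrow> int"
  have "simple_refl i \<circ> simple_refl j = simple_refl j \<circ> simple_refl i"
    using assms by (auto simp: fun_eq_iff transpose_def)
  then have "w \<circ> simple_refl i \<circ> simple_refl j = w \<circ> simple_refl j \<circ> simple_refl i"
    by (simp add: comp_assoc)
  then show "hecke_gen i (hecke_gen j F) w = hecke_gen j (hecke_gen i F) w"
    using assms by (simp add: hecke_gen_def algebra_simps)
qed

lemma hecke_gen_braid:
  "hecke_gen (i + 1) (hecke_gen i (hecke_gen (i + 1) F)) = hecke_gen i (hecke_gen (i + 1) (hecke_gen i F))"
proof
  fix w :: "int \<Rightarrow> int"
  let ?s = "simple_refl i" and ?t = "simple_refl (i + 1)"
  have "?t \<circ> ?s \<circ> ?t = ?s \<circ> ?t \<circ> ?s"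
    by (auto simp: fun_eq_iff transpose_def)
  then have "w \<circ> ?t \<circ> ?s \<circ> ?t = w \<circ> ?s \<circ> ?t \<circ> ?s"
    by (metis comp_assoc)
  then have [simp]: "w \<circ> transpose (1 + i) (i + 2) \<circ> transpose i (1 + i) \<circ> transpose (1 + i) (i + 2)
      = w \<circ> transpose i (1 + i) \<circ> transpose (1 + i) (i + 2) \<circ> transpose i (1 + i)"
    by (simp add: add.commute)
  have [simp]: "?s (i + 2) = i + 2" "?t i = i" "?t (i + 2) = i + 1" "?t (i + 1 + 1) = i + 1" "?s (i + 1 + 1) = i + 2"
    by (simp_all add: transpose_def)
  have two: "i + 1 + 1 = i + 2"
    by simp
  \<comment> \<open>Every descent condition that occurs compares two of the values at i, i+1, i+2,
    so the cases on their order settle both sides.\<close>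
  show "hecke_gen (i + 1) (hecke_gen i (hecke_gen (i + 1) F)) w
      = hecke_gen i (hecke_gen (i + 1) (hecke_gen i F)) w"
    unfolding hecke_gen_def two
    by (cases "w (i + 1) < w i"; cases "w (i + 2) < w (i + 1)"; cases "w (i + 2) < w i")
      (simp_all add: algebra_simps)
qed

lemmas hecke_simps = hecke_fac_def hecke_gen_add hecke_gen_scale hecke_gen_idem

lemma hecke_gen_fac_commute:
  "i + 1 < j \<Longrightarrow> hecke_gen i (hecke_fac j x F) = hecke_fac j x (hecke_gen i F)"
  by (simp add: hecke_simps hecke_gen_commute[of i j])

lemma hecke_fac_commute:
  "i + 1 < j \<Longrightarrow> hecke_fac i y (hecke_fac j x F) = hecke_fac j x (hecke_fac i y F)"
  by (simp add: hecke_simps hecke_gen_commute[of i j] algebra_simps)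

lemma hecke_gen_col_commute:
  "i + 1 < k \<Longrightarrow> hecke_gen i (hecke_col d k x F) = hecke_col d k x (hecke_gen i F)"
  by (induction d arbitrary: k) (simp_all add: hecke_gen_fac_commute[of i])

lemma hecke_fac_col_commute:
  "i + 1 < k \<Longrightarrow> hecke_fac i y (hecke_col d k x F) = hecke_col d k x (hecke_fac i y F)"
  by (induction d arbitrary: k) (simp_all add: hecke_fac_commute[of i])

lemma hecke_gen_prod_commute:
  "i + 1 < k \<Longrightarrow> hecke_gen i (hecke_prod d k F) = hecke_prod d k (hecke_gen i F)"
  by (induction d arbitrary: k F) (simp_all add: hecke_gen_col_commute[of i] hecke_gen_fac_commute[of i])

lemma hecke_fac_linear:
  "hecke_fac k x (\<lambda>w. c * F w + d * G w) = (\<lambda>w. c * hecke_fac k x F w + d * hecke_fac k x G w)"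
  by (simp add: hecke_simps algebra_simps)

lemma hecke_col_linear:
  "hecke_col n k x (\<lambda>w. c * F w + d * G w) = (\<lambda>w. c * hecke_col n k x F w + d * hecke_col n k x G w)"
  by (induction n arbitrary: k) (simp_all add: hecke_fac_linear)

lemma hecke_prod_linear:
  "hecke_prod n k (\<lambda>w. c * F w + d * G w) = (\<lambda>w. c * hecke_prod n k F w + d * hecke_prod n k G w)"
  by (induction n arbitrary: k F G) (simp_all add: hecke_col_linear hecke_fac_linear)

text \<open>The Yang--Baxter equation without denominators: the right-hand side is symmetric in
  \<open>x\<close> and \<open>y\<close> up to the dependence of \<open>S\<close> on \<open>y\<close>.\<close>

lemma hecke_fac_yang_baxter:
  fixes k P x y
  defines "S \<equiv> hecke_fac (k + 1) y P"
  shows "hecke_fac k y (hecke_fac (k + 1) y (hecke_fac k x P)) =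
    (\<lambda>w. S w + (x + y + \<beta> * x * y) * hecke_gen k S w
      + x * y * (hecke_gen (k + 1) (hecke_gen k S) w - hecke_gen k (hecke_gen (k + 1) S) w))"
  unfolding S_def by (simp add: hecke_simps hecke_gen_braid[unfolded add.commute[of _ 1]] algebra_simps)

lemma hecke_col_symmetric:
  "hecke_col d k y (hecke_col d k x F) = hecke_col d k x (hecke_col d k y F)"
proof (induction d arbitrary: k F)
  case (Suc d)
  show ?case
  proof (cases d)
    case 0
    then show ?thesis
      by (simp add: hecke_simps algebra_simps)
  next
    case (Suc e)
    \<comment> \<open>The factor in x with index k commutes past the y-factors with indices at least
      k+2; this exposes the Yang--Baxter pattern.\<close>
    have exp: "hecke_col (Suc d) k y (hecke_col (Suc d) k x F) = hecke_fac k y (hecke_fac (k + 1) y (hecke_fac k x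
        (hecke_col e (k + 1 + 1) y (hecke_col d (k + 1) x F))))" for x y
      by (simp add: Suc hecke_fac_col_commute)
    \<comment> \<open>By induction, the \<open>S\<close> of the Yang--Baxter identity is the same
      for both orders of x and y.\<close>
    have "hecke_fac (k + 1) y (hecke_col e (k + 1 + 1) y (hecke_col d (k + 1) x F))
        = hecke_fac (k + 1) x (hecke_col e (k + 1 + 1) x (hecke_col d (k + 1) y F))"
      using Suc.IH[of "k + 1" F] unfolding Suc by simp
    then show ?thesis
      unfolding exp hecke_fac_yang_baxter by (simp add: algebra_simps)
  qed
qed simp

text \<open>Symmetry of the columns gives P (1 + y u_k) = Q (1 + x u_k). Multiplied by u_k this
  becomes (1 + beta y) P u_k = (1 + beta x) Q u_k, and eliminating Q u_k leaves the claim. Later, Q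
  is P with its two variables swapped.\<close>

lemma hecke_col_div_diff:
  fixes d k x y F
  defines "P \<equiv> hecke_col d (k + 1) y (hecke_col (Suc d) k x F)"
    and "Q \<equiv> hecke_col d (k + 1) x (hecke_col (Suc d) k y F)"
  shows "(x - y) * (hecke_gen k P w - \<beta> * P w) = (1 + \<beta> * y) * P w - (1 + \<beta> * x) * Q w"
proof -
  have "hecke_fac k y P = hecke_fac k x Q"
    using hecke_col_symmetric[of "Suc d" k y x F] by (simp add: P_def Q_def)
  then have S: "P v + y * hecke_gen k P v = Q v + x * hecke_gen k Q v" for v
    by (simp add: hecke_fac_def fun_eq_iff)
  have "hecke_gen k (hecke_fac k y P) w = hecke_gen k (hecke_fac k x Q) w"
    by (simp add: \<open>hecke_fac k y P = hecke_fac k x Q\<close>)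
  then have U: "(1 + \<beta> * y) * hecke_gen k P w = (1 + \<beta> * x) * hecke_gen k Q w"
    by (simp add: hecke_simps algebra_simps)
  have "(1 + \<beta> * x) * Q w = (1 + \<beta> * x) * (P w + y * hecke_gen k P w) - x * ((1 + \<beta> * x) * hecke_gen k Q w)"
    by (simp add: S algebra_simps)
  also have "\<dots> = (1 + \<beta> * x) * (P w + y * hecke_gen k P w) - x * ((1 + \<beta> * y) * hecke_gen k P w)"
    by (simp only: U)
  finally show ?thesis
    by (simp add: algebra_simps)
qed

section \<open>Swapped variables and divided differences of the products\<close>

lemma swap_hecke_fac:
  "(\<lambda>w. swap_vars i (hecke_fac j x F w)) = hecke_fac j (swap_vars i x) (\<lambda>w. swap_vars i (F w))"
  by (simp add: hecke_fac_def hecke_gen_def swap_vars_add swap_vars_mult fun_eq_iff)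

lemma swap_hecke_col:
  "(\<lambda>w. swap_vars i (hecke_col d k x F w)) = hecke_col d k (swap_vars i x) (\<lambda>w. swap_vars i (F w))"
  by (induction d arbitrary: k) (simp_all add: swap_hecke_fac)

lemma swap_hecke_prod:
  assumes "i + 1 < k"
  shows "(\<lambda>w. swap_vars i (hecke_prod d k F w)) = hecke_prod d k (\<lambda>w. swap_vars i (F w))"
  using assms
proof (induction d arbitrary: k F)
  case (Suc d)
  have "swap_vars i (X k) = X k"
    using Suc.prems by (simp add: swap_vars_X transpose_def)
  then show ?case
    using Suc swap_hecke_col[of i "Suc d" k "X k" F] by simp
qed simp

text \<open>Columns before the i-th are invariant under the swap and are absorbed into
  \<open>F\<close>; columns i and i+1 are handled by \<open>hecke_col_div_diff\<close>; later ones
  are linear, swap-invariant and commute with u_i. The upper bound on i says that x_(i+1) has a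
  column.\<close>

lemma hecke_prod_div_diff:
  assumes "(\<lambda>w. swap_vars i (F w)) = F" "k \<le> i" "i + 2 \<le> k + int n"
  shows "is_div_diff_beta i (hecke_prod n k F w) (hecke_gen i (hecke_prod n k F) w - \<beta> * hecke_prod n k F w)"
  using assms
proof (induction n arbitrary: k F)
  case (Suc n)
  show ?case
  proof (cases "k = i")
    case False
    have "swap_vars i (X k) = X k"
      using Suc.prems False by (simp add: swap_vars_X transpose_def)
    then have "(\<lambda>w. swap_vars i (hecke_col (Suc n) k (X k) F w)) = hecke_col (Suc n) k (X k) F"
      unfolding swap_hecke_col Suc.prems(1) by simp
    then show ?thesis
      using Suc.IH[of "hecke_col (Suc n) k (X k) F" "k + 1"] Suc.prems False by simp
  next
    case True
    then obtain m where m: "n = Suc m"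
      using Suc.prems by (cases n) auto
    let ?x = "X i" and ?y = "X (i + 1)" and ?T = "hecke_prod m (i + 2)"
    define P where "P = hecke_col n (i + 1) ?y (hecke_col (Suc n) i ?x F)"
    define Q where "Q = hecke_col n (i + 1) ?x (hecke_col (Suc n) i ?y F)"
    have G: "hecke_prod (Suc n) k F = ?T P"
      by (simp add: True m P_def add.commute)
    have swap: "(\<lambda>w. swap_vars i (P w)) = Q"
      unfolding P_def Q_def swap_hecke_col Suc.prems(1) by (simp add: swap_vars_X)
    have swap_T: "swap_vars i (?T P w) = ?T Q w"
      using fun_cong[OF swap_hecke_prod[of i "i + 2" m P], of w] unfolding swap by simp
    \<comment> \<open>Signs are moved into the coefficients so that \<open>hecke_prod_linear\<close>
      can carry the identity through the later columns.\<close>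
    have "(\<lambda>w. (?x - ?y) * hecke_gen i P w + (- (?x - ?y) * \<beta>) * P w)
        = (\<lambda>w. (1 + \<beta> * ?y) * P w + (- (1 + \<beta> * ?x)) * Q w)"
    proof
      fix w
      have "(?x - ?y) * hecke_gen i P w + (- (?x - ?y) * \<beta>) * P w = (?x - ?y) * (hecke_gen i P w - \<beta> * P w)"
        by (simp add: algebra_simps)
      also have "\<dots> = (1 + \<beta> * ?y) * P w - (1 + \<beta> * ?x) * Q w"
        unfolding P_def Q_def by (rule hecke_col_div_diff)
      finally show "(?x - ?y) * hecke_gen i P w + (- (?x - ?y) * \<beta>) * P w
          = (1 + \<beta> * ?y) * P w + (- (1 + \<beta> * ?x)) * Q w"
        by (simp only: mult_minus_left diff_conv_add_uminus)
    qed
    then have "?T (\<lambda>w. (?x - ?y) * hecke_gen i P w + (- (?x - ?y) * \<beta>) * P w) w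
        = ?T (\<lambda>w. (1 + \<beta> * ?y) * P w + (- (1 + \<beta> * ?x)) * Q w) w"
      by simp
    then have eq: "(?x - ?y) * ?T (hecke_gen i P) w + (- (?x - ?y) * \<beta>) * ?T P w
        = (1 + \<beta> * ?y) * ?T P w + (- (1 + \<beta> * ?x)) * ?T Q w"
      unfolding hecke_prod_linear .
    have comm: "?T (hecke_gen i P) = hecke_gen i (?T P)"
      by (simp add: hecke_gen_prod_commute)
    have "a * (u - b * p) = c * p - d * q"
      if "a * u + (- a * b) * p = c * p + (- d) * q" for a b c d p q u :: beta_mpoly
      using that by (simp add: right_diff_distrib mult.assoc)
    from this[OF eq[unfolded comm]] show ?thesis
      unfolding G is_div_diff_beta_def swap_T .
  qed
qed simp

section \<open>Stability of the coefficients as the product grows\<close>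

lemma hecke_fac_stable:
  assumes "\<And>w. w \<in> S_fin n \<Longrightarrow> F w = F' w" "0 < i" "i < n" "w \<in> S_fin n"
  shows "hecke_fac i x F w = hecke_fac i x F' w"
  using assms by (simp add: hecke_fac_def hecke_gen_def)

text \<open>The longer column has one extra initial factor, of index k+d. Elements of
  \<open>S_fin (k + int d)\<close> ascend there, so it does not touch their coefficients, and the
  other factors stay inside that group.\<close>

lemma hecke_col_stable:
  assumes "\<And>w. w \<in> S_fin (k + int d) \<Longrightarrow> F w = F' w" "0 < k" "w \<in> S_fin (k + int d)"
  shows "hecke_col (Suc d) k x F w = hecke_col d k x F' w"
  using assms
proof (induction d arbitrary: k w)
  case 0
  then have "w k < w (k + 1)"
    using S_fin_ascent[of w k k] by simp
  then show ?case
    using 0 by (simp add: hecke_fac_def hecke_gen_def)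
next
  case (Suc d)
  have "hecke_fac k x (hecke_col (Suc d) (k + 1) x F) w = hecke_fac k x (hecke_col d (k + 1) x F') w"
  proof (rule hecke_fac_stable)
    show "hecke_col (Suc d) (k + 1) x F v = hecke_col d (k + 1) x F' v" if "v \<in> S_fin (k + 1 + int d)" for v
      using that Suc.prems by (intro Suc.IH) (auto simp: algebra_simps)
  qed (use Suc.prems in \<open>simp_all add: algebra_simps\<close>)
  then show ?case
    by simp
qed

lemma hecke_prod_Suc_stable:
  assumes "\<And>w. w \<in> S_fin (k + int n) \<Longrightarrow> F w = F' w" "0 < k" "w \<in> S_fin (k + int n)"
  shows "hecke_prod (Suc n) k F w = hecke_prod n k F' w"
  using assms
proof (induction n arbitrary: k w F F')
  case 0
  then show ?case
    using hecke_col_stable[of k 0 F F' w "X k"] by simp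
next
  case (Suc n)
  have "hecke_prod (Suc n) (k + 1) (hecke_col (Suc (Suc n)) k (X k) F) w
      = hecke_prod n (k + 1) (hecke_col (Suc n) k (X k) F') w"
  proof (rule Suc.IH)
    show "hecke_col (Suc (Suc n)) k (X k) F v = hecke_col (Suc n) k (X k) F' v"
      if "v \<in> S_fin (k + 1 + int n)" for v
      using that Suc.prems by (intro hecke_col_stable) (auto simp: algebra_simps)
  qed (use Suc.prems in \<open>simp_all add: algebra_simps\<close>)
  then show ?case
    by simp
qed

lemma hecke_prod_stable:
  assumes "w \<in> S_fin (int m + 1)" "m \<le> n"
  shows "hecke_prod n 1 F w = hecke_prod m 1 F w"
  using assms(2)
proof (induction n rule: dec_induct)
  case (step n)
  have "w \<in> S_fin (1 + int n)"
    using assms(1) step S_fin_mono[of "int m + 1" "1 + int n"] by auto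
  then have "hecke_prod (Suc n) 1 F w = hecke_prod n 1 F w"
    by (intro hecke_prod_Suc_stable) simp_all
  then show ?case
    using step.IH by (simp only:)
qed simp

section \<open>The coefficient of the longest permutation\<close>

definition length_bounded :: "nat \<Rightarrow> hecke \<Rightarrow> bool" where
  "length_bounded m F \<longleftrightarrow> (\<forall>w\<in>S_inf. m < perm_length w \<longrightarrow> F w = 0)"

lemma hecke_fac_length_bounded:
  assumes "length_bounded m F" "i > 0"
  shows "length_bounded (Suc m) (hecke_fac i x F)"
proof -
  have "hecke_fac i x F w = 0" if w: "w \<in> S_inf" "Suc m < perm_length w" for w
  proof -
    have "F w = 0"
      using assms w by (simp add: length_bounded_def)
    moreover have "F (w \<circ> simple_refl i) = 0" if "w (i + 1) < w i"
      using assms w perm_length_descent[OF w(1) assms(2) that] by (simp add: length_bounded_def)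
    ultimately show ?thesis
      by (simp add: hecke_fac_def hecke_gen_def)
  qed
  then show ?thesis
    by (simp add: length_bounded_def)
qed

text \<open>Since \<open>w s_i\<close> is longer than the bound, its coefficient in \<open>F\<close>
  vanishes and with it the beta term of \<open>hecke_gen\<close>.\<close>

lemma hecke_fac_top:
  assumes "length_bounded m F" "i > 0" "w \<in> S_inf" "perm_length w = m" "w i < w (i + 1)"
  shows "hecke_fac i x F (w \<circ> simple_refl i) = x * F w"
proof -
  have "F (w \<circ> simple_refl i) = 0"
    using assms perm_length_ascent[OF assms(3,5)] by (simp add: length_bounded_def)
  then show ?thesis
    using assms(5) by (simp add: hecke_fac_def hecke_gen_def)
qed

text \<open>The cycle s_(k+d-1) ... s_k, read off a column by taking u_j from every factor.\<close>

definition shift_perm :: "nat \<Rightarrow> int \<Rightarrow> int \<Rightarrow> int" where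
  "shift_perm d k p = (if p = k then k + int d else if k < p \<and> p \<le> k + int d then p - 1 else p)"

lemma shift_perm_0: "shift_perm 0 k = id"
  by (auto simp: shift_perm_def fun_eq_iff)

lemma shift_perm_Suc: "shift_perm (Suc d) k = shift_perm d (k + 1) \<circ> simple_refl k"
  by (auto simp: shift_perm_def fun_eq_iff transpose_def)

text \<open>The length can reach m + d only by taking u_j from all d factors. By the last hypothesis
  the value at k+d passes only smaller values on its way to position k, so every letter
  lengthens.\<close>

lemma hecke_col_top:
  assumes "length_bounded m F" "w \<in> S_inf" "perm_length w = m" "k > 0"
    and "\<And>p. k \<le> p \<Longrightarrow> p < k + int d \<Longrightarrow> w p < w (k + int d)"
  shows "length_bounded (m + d) (hecke_col d k x F) \<and> w \<circ> shift_perm d k \<in> S_inf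
    \<and> perm_length (w \<circ> shift_perm d k) = m + d
    \<and> hecke_col d k x F (w \<circ> shift_perm d k) = x ^ d * F w"
  using assms
proof (induction d arbitrary: k)
  case 0
  then show ?case
    by (simp add: shift_perm_0)
next
  case (Suc d)
  define v where "v = w \<circ> shift_perm d (k + 1)"
  have "length_bounded (m + d) (hecke_col d (k + 1) x F) \<and> v \<in> S_inf \<and> perm_length v = m + d
      \<and> hecke_col d (k + 1) x F v = x ^ d * F w"
    unfolding v_def
  proof (rule Suc.IH)
    show "w p < w (k + 1 + int d)" if "k + 1 \<le> p" "p < k + 1 + int d" for p
      using Suc.prems(5)[of p] that by (simp add: algebra_simps)
  qed (use Suc.prems in simp_all)
  then have IH: "length_bounded (m + d) (hecke_col d (k + 1) x F)" "v \<in> S_inf" "perm_length v = m + d"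
    "hecke_col d (k + 1) x F v = x ^ d * F w"
    by blast+
  have asc: "v k < v (k + 1)"
    using Suc.prems(5)[of k] by (simp add: v_def shift_perm_def algebra_simps)
  have eq: "w \<circ> shift_perm (Suc d) k = v \<circ> simple_refl k"
    by (simp add: v_def shift_perm_Suc comp_assoc)
  have "length_bounded (Suc (m + d)) (hecke_col (Suc d) k x F) \<and> v \<circ> simple_refl k \<in> S_inf
      \<and> perm_length (v \<circ> simple_refl k) = Suc (m + d)
      \<and> hecke_col (Suc d) k x F (v \<circ> simple_refl k) = x ^ Suc d * F w"
    using hecke_fac_length_bounded[OF IH(1)] hecke_fac_top[OF IH(1) _ IH(2,3) asc]
      perm_length_ascent[OF IH(2) asc] IH Suc.prems(4)
    by (simp add: mult.assoc)
  then show ?case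
    by (simp only: eq add_Suc_right)
qed

text \<open>The permutation reached after k columns: the k largest values decreasing, then the rest
  of 1..n+1 increasing.\<close>

definition partial_rev :: "nat \<Rightarrow> nat \<Rightarrow> int \<Rightarrow> int" where
  "partial_rev n k p = (if 1 \<le> p \<and> p \<le> int k then int n + 2 - p
    else if int k < p \<and> p \<le> int n + 1 then p - int k else p)"

lemma partial_rev_0: "partial_rev n 0 = id"
  by (auto simp: partial_rev_def fun_eq_iff)

lemma partial_rev_Suc: "partial_rev (k + Suc d) k \<circ> shift_perm (Suc d) (int k + 1) = partial_rev (k + Suc d) (Suc k)"
  by (auto simp: partial_rev_def shift_perm_def fun_eq_iff)

lemma partial_rev_self: "partial_rev n n = longest_perm (Suc n)"
  by (auto simp: partial_rev_def longest_perm_def fun_eq_iff)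

text \<open>Column k+1 carries the value at the last position k+d+1 to position k+1 and contributes
  d factors \<open>X (k + 1)\<close>.\<close>

lemma hecke_prod_top:
  assumes "length_bounded m F" "partial_rev (k + d) k \<in> S_inf" "perm_length (partial_rev (k + d) k) = m"
  shows "partial_rev (k + d) (k + d) \<in> S_inf \<and> hecke_prod d (int k + 1) F (partial_rev (k + d) (k + d))
    = (\<Prod>j = Suc k..<Suc (k + d). X (int j) ^ (Suc (k + d) - j)) * F (partial_rev (k + d) k)"
  using assms
proof (induction d arbitrary: k m F)
  case 0
  then show ?case
    by simp
next
  case (Suc d)
  let ?n = "k + Suc d" and ?F = "hecke_col (Suc d) (int k + 1) (X (int k + 1)) F"
  have "partial_rev ?n k p < partial_rev ?n k (int k + 1 + int (Suc d))"
    if "int k + 1 \<le> p" "p < int k + 1 + int (Suc d)" for p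
    using that by (simp add: partial_rev_def)
  then have col: "length_bounded (m + Suc d) ?F" "partial_rev ?n (Suc k) \<in> S_inf"
      "perm_length (partial_rev ?n (Suc k)) = m + Suc d"
      "?F (partial_rev ?n (Suc k)) = X (int k + 1) ^ Suc d * F (partial_rev ?n k)"
    using hecke_col_top[OF Suc.prems, of "int k + 1" "Suc d" "X (int k + 1)"]
    unfolding partial_rev_Suc by simp_all
  have n: "?n = Suc k + d"
    by simp
  have IH: "partial_rev ?n ?n \<in> S_inf \<and> hecke_prod d (int (Suc k) + 1) ?F (partial_rev ?n ?n)
      = (\<Prod>j = Suc (Suc k)..<Suc ?n. X (int j) ^ (Suc ?n - j)) * ?F (partial_rev ?n (Suc k))"
    using col(1-3) unfolding n by (rule Suc.IH)
  have "hecke_prod (Suc d) (int k + 1) F = hecke_prod d (int (Suc k) + 1) ?F"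
    by (simp add: add.commute)
  moreover have "(\<Prod>j = Suc k..<Suc ?n. X (int j) ^ (Suc ?n - j))
      = X (int k + 1) ^ Suc d * (\<Prod>j = Suc (Suc k)..<Suc ?n. X (int j) ^ (Suc ?n - j))"
    by (subst prod.atLeast_Suc_lessThan) (simp_all add: add.commute)
  ultimately show ?case
    using IH col(4) by (simp only: mult_ac simp_thms)
qed

section \<open>The Grothendieck polynomials\<close>

definition hecke_one :: hecke where
  "hecke_one w = (if w = id then 1 else 0)"

lemma hecke_prod_longest_perm:
  "hecke_prod n 1 hecke_one (longest_perm (Suc n)) = (\<Prod>j=1..<Suc n. X (int j) ^ (Suc n - j))"
proof -
  have "length_bounded 0 hecke_one"
    by (auto simp: length_bounded_def hecke_one_def)
  then show ?thesis
    using hecke_prod_top[of 0 hecke_one 0 n] by (simp add: partial_rev_0 partial_rev_self hecke_one_def)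
qed

lemma longest_perm_in_S_fin: "longest_perm n \<in> S_fin (int n)"
proof -
  have "longest_perm n (longest_perm n p) = p" for p
    by (auto simp: longest_perm_def)
  then have "bij (longest_perm n)"
    by (intro o_bij[of "longest_perm n"]) (auto simp: fun_eq_iff)
  moreover have "{p. longest_perm n p \<noteq> p} \<subseteq> {1..int n}"
    by (auto simp: longest_perm_def)
  then have "finite {p. longest_perm n p \<noteq> p}"
    by (rule finite_subset) simp
  ultimately show ?thesis
    by (auto simp: S_fin_def S_inf_def longest_perm_def)
qed

text \<open>The product with n columns involves u_1, ..., u_n, hence permutations of 1..n+1; by
  \<open>hecke_prod_stable\<close> a larger n gives the same coefficient.\<close>

definition hecke_grothendieck :: "(int \<Rightarrow> int) \<Rightarrow> beta_mpoly" where
  "hecke_grothendieck = restrict (\<lambda>w. hecke_prod (LEAST n. w \<in> S_fin (int n + 1)) 1 hecke_one w) S_inf"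

lemma hecke_grothendieck_eq:
  assumes "w \<in> S_fin (int n + 1)"
  shows "hecke_grothendieck w = hecke_prod n 1 hecke_one w"
proof -
  let ?m = "LEAST n. w \<in> S_fin (int n + 1)"
  have "hecke_grothendieck w = hecke_prod ?m 1 hecke_one w"
    using S_finD(1)[OF assms] by (simp add: hecke_grothendieck_def)
  also have "\<dots> = hecke_prod n 1 hecke_one w"
  proof (rule hecke_prod_stable[symmetric])
    show "w \<in> S_fin (int ?m + 1)"
      using assms by (rule LeastI)
    show "?m \<le> n"
      using assms by (rule Least_le)
  qed
  finally show ?thesis .
qed

text \<open>This reads off P (u_i - beta) at \<open>w\<close>: at a descent the beta terms cancel
  and the coefficient of \<open>w s_i\<close> is left; at an ascent u_i contributes nothing.\<close>

lemma hecke_grothendieck_div_diff: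
  assumes w: "w \<in> S_inf" and i: "i > 0"
  shows "is_div_diff_beta i (hecke_grothendieck w)
    (if w i > w (i + 1) then hecke_grothendieck (w \<circ> simple_refl i) else - \<beta> * hecke_grothendieck w)"
proof -
  obtain m :: nat where m: "w \<in> S_fin (int m)"
    using S_inf_imp_S_fin[OF w] .
  \<comment> \<open>Both \<open>w\<close> and \<open>w s_i\<close> must lie in
    \<open>S_fin (n + 1)\<close>, and i + 1 <= n is needed for x_(i+1) to have a column.\<close>
  define n where "n = max m (nat i + 1)"
  have "int m \<le> int n + 1" "i < int n + 1"
    by (auto simp: n_def)
  then have wn: "w \<in> S_fin (int n + 1)" and ws: "w \<circ> simple_refl i \<in> S_fin (int n + 1)"
    using m i S_fin_mono comp_in_S_fin simple_refl_in_S_fin by blast+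
  have "(\<lambda>w. swap_vars i (hecke_one w)) = hecke_one"
    by (auto simp: hecke_one_def)
  then have "is_div_diff_beta i (hecke_prod n 1 hecke_one w)
      (hecke_gen i (hecke_prod n 1 hecke_one) w - \<beta> * hecke_prod n 1 hecke_one w)"
    using i by (intro hecke_prod_div_diff) (auto simp: n_def)
  then show ?thesis
    by (simp add: hecke_grothendieck_eq[OF wn] hecke_grothendieck_eq[OF ws] hecke_gen_def split: if_splits)
qed

lemma is_grothendieck_family_hecke_grothendieck: "is_grothendieck_family hecke_grothendieck"
  unfolding is_grothendieck_family_def
proof (intro conjI ballI allI impI)
  show "hecke_grothendieck \<in> extensional S_inf"
    by (simp add: hecke_grothendieck_def)
next
  fix n :: nat
  assume "1 \<le> n"
  then obtain m where "n = Suc m"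
    by (cases n) auto
  then show "hecke_grothendieck (longest_perm n) = (\<Prod>k=1..<n. X (int k) ^ (n - k))"
    using hecke_grothendieck_eq[of "longest_perm n" m] longest_perm_in_S_fin[of n] hecke_prod_longest_perm[of m]
    by (simp add: add.commute)
next
  fix w i
  assume "w \<in> S_inf" "(0::int) < i"
  then show "div_diff_beta i (hecke_grothendieck w) =
      (if w (i + 1) < w i then hecke_grothendieck (w \<circ> simple_refl i) else - \<beta> * hecke_grothendieck w)"
    by (intro is_div_diff_betaD hecke_grothendieck_div_diff)
qed

section \<open>Uniqueness of the Grothendieck family\<close>

lemma no_inner_ascent_imp_longest:
  assumes w: "w \<in> S_fin (int n)" and desc: "\<And>i. 0 < i \<Longrightarrow> i < int n \<Longrightarrow> w (i + 1) < w i"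
  shows "w = longest_perm n"
proof
  fix p
  have wS: "w \<in> S_inf"
    using S_finD(1)[OF w] .
  have step: "w (a + int k) + int k \<le> w a" if "0 < a" "a + int k \<le> int n" for a k
    using that
  proof (induction k)
    case (Suc k)
    have "w (a + int k + 1) < w (a + int k)"
      using Suc.prems by (intro desc) auto
    then show ?case
      using Suc by (simp add: algebra_simps)
  qed simp
  show "w p = longest_perm n p"
  proof (cases "1 \<le> p \<and> p \<le> int n")
    case True
    have "w p + int (nat (p - 1)) \<le> w 1" "w (int n) + int (nat (int n - p)) \<le> w p"
      using step[of 1 "nat (p - 1)"] step[of p "nat (int n - p)"] True by simp_all
    moreover have "w 1 \<le> int n" "w (int n) > 0"
      using S_finD(3)[OF w, of 1] S_inf_pos[OF wS, of "int n"] True by simp_all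
    ultimately show ?thesis
      using True by (simp add: longest_perm_def)
  next
    case False
    then have "w p = p"
      using S_infD(4)[OF wS, of p] S_finD(2)[OF w, of p] by linarith
    then show ?thesis
      using False by (auto simp: longest_perm_def)
  qed
qed

text \<open>Downward induction on length from the longest element, whose value is prescribed. Any
  other \<open>w\<close> ascends at some i < n, and its value is the beta divided difference of that
  at the longer \<open>w s_i\<close>.\<close>

lemma is_grothendieck_family_unique:
  assumes G: "is_grothendieck_family G" and G': "is_grothendieck_family G'"
  shows "G = G'"
proof -
  have eq: "G w = G' w" if "w \<in> S_fin (int n)" "n \<ge> 1" for w n
    using that
  \<comment> \<open>\<open>n * n\<close> bounds the lengths in \<open>S_fin n\<close>, so the
    measure drops as the length grows.\<close>
  proof (induction "n * n - perm_length w" arbitrary: w rule: less_induct)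
    case less
    show ?case
    proof (cases "w = longest_perm n")
      case True
      then show ?thesis
        using G G' less.prems by (simp add: is_grothendieck_family_def)
    next
      case False
      have w: "w \<in> S_inf"
        using S_finD(1)[OF less.prems(1)] .
      obtain i where i: "0 < i" "i < int n" "w i < w (i + 1)"
        using no_inner_ascent_imp_longest[OF less.prems(1)] False S_inf_neq_Suc(1)[OF w]
        by (metis linorder_neqE)
      define v where "v = w \<circ> simple_refl i"
      have v: "v \<in> S_fin (int n)" "v \<in> S_inf" "v (i + 1) < v i" "v \<circ> simple_refl i = w"
        using i less.prems w by (simp_all add: v_def)
      have "perm_length v = Suc (perm_length w)" "perm_length v \<le> n * n"
        using perm_length_ascent[OF w i(3)] perm_length_le[OF v(1)] by (simp_all add: v_def)
      then have "G v = G' v"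
        using v less.prems(2) by (intro less.hyps) simp_all
      moreover have "div_diff_beta i (H v) = H w" if "is_grothendieck_family H" for H
        using that v i by (simp add: is_grothendieck_family_def)
      ultimately show ?thesis
        using G G' by metis
    qed
  qed
  show ?thesis
  proof (rule extensionalityI)
    show "G \<in> extensional S_inf" "G' \<in> extensional S_inf"
      using G G' by (simp_all add: is_grothendieck_family_def)
    show "G w = G' w" if w: "w \<in> S_inf" for w
    proof -
      obtain n :: nat where n: "w \<in> S_fin (int n)"
        using S_inf_imp_S_fin[OF w] .
      then have "w \<in> S_fin (int (Suc n))"
        using S_fin_mono[of "int n" "int (Suc n)"] by auto
      then show ?thesis
        by (rule eq) simp
    qed
  qed
qed

lemma grothendieck_eq: "grothendieck = hecke_grothendieck"
  unfolding grothendieck_def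
  using is_grothendieck_family_hecke_grothendieck is_grothendieck_family_unique
  by (intro the_equality) auto

lemma grothendieck_descent:
  "w \<in> S_inf \<Longrightarrow> i > 0 \<Longrightarrow> w (i + 1) < w i \<Longrightarrow>
    is_div_diff_beta i (grothendieck w) (grothendieck (w \<circ> simple_refl i))"
  using hecke_grothendieck_div_diff[of w i] by (simp add: grothendieck_eq)

lemma grothendieck_ascent:
  "w \<in> S_inf \<Longrightarrow> i > 0 \<Longrightarrow> w i < w (i + 1) \<Longrightarrow>
    is_div_diff_beta i (grothendieck w) (- \<beta> * grothendieck w)"
  using hecke_grothendieck_div_diff[of w i] by (simp add: grothendieck_eq)

section \<open>Divided differences of involution Grothendieck polynomials\<close>

definition inv_term :: "(int \<Rightarrow> int) \<Rightarrow> (int \<Rightarrow> int) \<Rightarrow> beta_mpoly" where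
  "inv_term z w = \<beta> ^ (perm_length w - inv_length z) * grothendieck w"

lemma inv_grothendieck_eq: "inv_grothendieck z = sum (inv_term z) (B_inv z)"
  by (simp add: inv_grothendieck_def inv_term_def)

lemma inv_term_ascent:
  assumes "w \<in> S_inf" "i > 0" "w i < w (i + 1)"
  shows "is_div_diff_beta i (inv_term z w) (- \<beta> * inv_term z w)"
  using is_div_diff_beta_scale[OF grothendieck_ascent[OF assms]]
  by (simp add: inv_term_def mult.left_commute)

lemma inv_term_descent:
  assumes "v \<in> S_inf" "i > 0" "v i < v (i + 1)"
  shows "is_div_diff_beta i (inv_term z (v \<circ> simple_refl i))
    (\<beta> ^ (Suc (perm_length v) - inv_length z) * grothendieck v)"
  using is_div_diff_beta_scale[OF grothendieck_descent[of "v \<circ> simple_refl i" i]] assms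
    perm_length_ascent[OF assms(1,3)]
  by (simp add: inv_term_def)

text \<open>By \<open>B_inv_ascent\<close> every atom of \<open>z\<close> ascends at i, so each
  summand is multiplied by -beta.\<close>

lemma div_diff_inv_grothendieck_ascent:
  assumes "z \<in> S_inf" "i > 0" "z i < z (i + 1)"
  shows "div_diff_beta i (inv_grothendieck z) = - \<beta> * inv_grothendieck z"
proof -
  have "is_div_diff_beta i (sum (inv_term z) (B_inv z)) (\<Sum>w\<in>B_inv z. - \<beta> * inv_term z w)"
    using assms B_inv_ascent by (intro is_div_diff_beta_sum inv_term_ascent) (auto simp: B_inv_iff)
  then show ?thesis
    unfolding inv_grothendieck_eq by (simp only: is_div_diff_betaD sum_distrib_left)
qed

text \<open>The atoms of \<open>z\<close> with an ascent at \<open>i\<close> cancel against their products with \<open>s\<^sub>i\<close>; what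
  remains comes from the atoms of \<^term>\<open>lower_conj i z\<close>.\<close>

lemma div_diff_inv_grothendieck_descent:
  assumes z: "z \<in> S_inf" "z \<circ> z = id" and i: "i > 0" and desc: "z (i + 1) < z i"
  shows "div_diff_beta i (inv_grothendieck z) = inv_grothendieck (lower_conj i z)"
proof -
  define N where "N = {v \<in> B_inv z. v i < v (i + 1)}"
  let ?y = "lower_conj i z" and ?r = "\<lambda>v :: int \<Rightarrow> int. v \<circ> simple_refl i"
  note y = lower_conj[OF assms]
  have len: "inv_length z = Suc (inv_length ?y)"
    using inv_length_dem_conj[OF y(1,2) i y(3)] y(4) by simp
  have fin: "finite N" "finite (B_inv ?y)"
    using finite_B_inv z(1) y(1) by (simp_all add: N_def)
  have N: "v \<in> S_inf" "v i < v (i + 1)" "inv_length z \<le> perm_length v" if "v \<in> N" for v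
    using that inv_length_dem_square_le[of v] by (auto simp: N_def B_inv_iff)
  have Y: "v \<in> S_inf" "v i < v (i + 1)" "inv_length ?y \<le> perm_length v" if "v \<in> B_inv ?y" for v
    using that inv_length_dem_square_le[of v] B_inv_ascent[OF that i y(3)] by (auto simp: B_inv_iff)
  \<comment> \<open>A common atom would force \<open>z\<close> = \<open>?y\<close>, but
    \<open>z\<close> descends at i and \<open>?y\<close> ascends.\<close>
  have disj: "N \<inter> B_inv ?y = {}"
    using y(3) desc by (auto simp: N_def B_inv_iff)
  have disj': "N \<inter> ?r ` (N \<union> B_inv ?y) = {}"
  proof (rule ccontr)
    assume "N \<inter> ?r ` (N \<union> B_inv ?y) \<noteq> {}"
    then obtain v where v: "v \<in> N \<union> B_inv ?y" "?r v \<in> N"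
      by blast
    then have "v i < v (i + 1)"
      using N(2) Y(2) by blast
    then show False
      using N(2)[OF v(2)] by simp
  qed
  have inj: "inj_on ?r (N \<union> B_inv ?y)"
    by (rule inj_onI) (metis comp_simple_refl_twice)
  have "inv_grothendieck z = sum (inv_term z) N + sum (inv_term z) (?r ` (N \<union> B_inv ?y))"
    unfolding inv_grothendieck_eq using fin disj'
    by (subst B_inv_descent_eq[OF assms, folded N_def], subst sum.union_disjoint) auto
  also have "sum (inv_term z) (?r ` (N \<union> B_inv ?y))
      = (\<Sum>v\<in>N. inv_term z (?r v)) + (\<Sum>v\<in>B_inv ?y. inv_term z (?r v))"
    using inj fin disj by (simp add: sum.reindex sum.union_disjoint)
  finally have eq: "inv_grothendieck z = sum (inv_term z) N
      + ((\<Sum>v\<in>N. inv_term z (?r v)) + (\<Sum>v\<in>B_inv ?y. inv_term z (?r v)))" .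
  have "is_div_diff_beta i (sum (inv_term z) N) (\<Sum>v\<in>N. - \<beta> * inv_term z v)"
    using N i by (intro is_div_diff_beta_sum inv_term_ascent) auto
  moreover have "is_div_diff_beta i (\<Sum>v\<in>N. inv_term z (?r v)) (\<Sum>v\<in>N. \<beta> * inv_term z v)"
  proof (rule is_div_diff_beta_sum)
    fix v
    assume v: "v \<in> N"
    \<comment> \<open>The extra letter leaves one more factor beta, which cancels the -beta from
      \<open>v\<close> itself; \<open>N(3)\<close> excludes truncation.\<close>
    have "\<beta> ^ (Suc (perm_length v) - inv_length z) * grothendieck v = \<beta> * inv_term z v"
      using N(3)[OF v] by (simp add: inv_term_def Suc_diff_le mult.assoc)
    then show "is_div_diff_beta i (inv_term z (?r v)) (\<beta> * inv_term z v)"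
      using inv_term_descent[OF N(1)[OF v] i N(2)[OF v], of z] by simp
  qed
  moreover have "is_div_diff_beta i (\<Sum>v\<in>B_inv ?y. inv_term z (?r v)) (\<Sum>v\<in>B_inv ?y. inv_term ?y v)"
  proof (rule is_div_diff_beta_sum)
    fix v
    assume v: "v \<in> B_inv ?y"
    \<comment> \<open>Both the length and \<open>inv_length\<close> are one larger for
      \<open>z\<close> than for \<open>?y\<close>, so the exponents agree.\<close>
    show "is_div_diff_beta i (inv_term z (?r v)) (inv_term ?y v)"
      using inv_term_descent[OF Y(1)[OF v] i Y(2)[OF v], of z] by (simp add: len inv_term_def)
  qed
  ultimately have "is_div_diff_beta i (inv_grothendieck z)
      ((\<Sum>v\<in>N. - \<beta> * inv_term z v) + ((\<Sum>v\<in>N. \<beta> * inv_term z v) + (\<Sum>v\<in>B_inv ?y. inv_term ?y v)))"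
    unfolding eq by (intro is_div_diff_beta_add)
  then have "is_div_diff_beta i (inv_grothendieck z) (sum (inv_term ?y) (B_inv ?y))"
    by (simp add: sum_negf)
  then show ?thesis
    unfolding inv_grothendieck_eq[of ?y] by (rule is_div_diff_betaD)
qed

theorem theorem3p3:
  fixes z :: "int \<Rightarrow> int" and i :: int
  assumes "z \<in> S_inf" and "z \<circ> z = id" and "i > 0"
  shows "(z i > z (i + 1) \<and> z i = i + 1 \<longrightarrow>
            div_diff_beta i (inv_grothendieck z) = inv_grothendieck (z \<circ> simple_refl i)) \<and>
         (z i > z (i + 1) \<and> z i \<noteq> i + 1 \<longrightarrow>
            div_diff_beta i (inv_grothendieck z) =
              inv_grothendieck (simple_refl i \<circ> z \<circ> simple_refl i)) \<and>
         (z i < z (i + 1) \<longrightarrow>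
            div_diff_beta i (inv_grothendieck z) = - \<beta> * inv_grothendieck z)"
  using div_diff_inv_grothendieck_descent[OF assms] div_diff_inv_grothendieck_ascent[OF assms(1,3)]
  by (auto simp: lower_conj_def)

end
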